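(* Let $p$ be an odd prime and let $f:\mathbb{F}_{p^{2k}}\to\mathbb{F}_p$ satisfy Condition A with sign $\epsilon$. Let $D_{\mathcal N}=\{x\in\mathbb{F}_{p^{2k}}^*: f(x)\text{ is a non-square in }\mathbb{F}_p\}$. Then $D_{\mathcal N}$ is a $(v,d,\lambda_1,\lambda_2)$ partial difference set in the additive group of $\mathbb{F}_{p^{2k}}$ with $v=p^{2k}$, $d=\frac12(p^k-p^{k-1})(p^k-\epsilon)$, $\lambda_1=\frac14(p^k-p^{k-1})^2-\frac{3\epsilon}{2}(p^k-p^{k-1})+\epsilon p^k$, $\lambda_2=\frac12(p^k-p^{k-1})\left(\frac12(p^k-p^{k-1})-\epsilon\right)$.
   Context: Let $\zeta_p$ be a primitive complex $p$-th root of unity and $\mathrm{tr}$ the absolute trace from $\mathbb{F}_{p^{2k}}$ to $\mathbb{F}_p$. For $f:\mathbb{F}_{p^{2k}}\to\mathbb{F}_p$ the Walsh transform is $\mathcal{W}_f(b)=\sum_{x\in\mathbb{F}_{p^{2k}}}\zeta_p^{f(x)+\mathrm{tr}(bx)}$. Condition A: $p$ is an odd prime and $f:\mathbb{F}_{p^{2k}}\to\mathbb{F}_p$ satisfies $f(0)=0$, $f(-x)=f(x)$ for all $x$; there is an integer $l$ with $\gcd(l-1,p-1)=1$ such that $f(\alpha x)=\alpha^l f(x)$ for all $\alpha\in\mathbb{F}_p$, $x\in\mathbb{F}_{p^{2k}}$; and there exist a constant $\epsilon\in\{1,-1\}$ and a function $f^*:\mathbb{F}_{p^{2k}}\to\mathbb{F}_p$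 such that $\mathcal{W}_f(b)=\epsilon p^k\zeta_p^{f^*(b)}$ for all $b\in\mathbb{F}_{p^{2k}}$. A $d$-subset $D$ of a finite abelian group $G$ (written additively, of order $v$) with $0\notin D$ is a $(v,d,\lambda,\mu)$ partial difference set if every nonzero element of $D$ can be written as $g-h$ with $g,h\in D$ in exactly $\lambda$ ways, and every nonzero element of $G\setminus D$ can be written so in exactly $\mu$ ways. *)

theory Defs
  imports Complex_Main "HOL-Computational_Algebra.Primes"
begin

text \<open>The finite field F_{p^{2k}} is modelled by a finite field type 'a with
  CARD('a) = p^(2k); F_p is its prime subfield {of_nat i | i < p}.\<close>

definition prime_subfield :: "nat \<Rightarrow> 'a::field set" where
  "prime_subfield p = {of_nat i | i. i < p}"

definition fp_index :: "nat \<Rightarrow> 'a::field \<Rightarrow> nat" where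
  "fp_index p y = (THE i. i < p \<and> of_nat i = y)"

definition abs_trace :: "nat \<Rightarrow> nat \<Rightarrow> 'a::field \<Rightarrow> 'a" where
  "abs_trace p k x = (\<Sum>i<2*k. x ^ (p ^ i))"

definition zeta_pow :: "nat \<Rightarrow> 'a::field \<Rightarrow> complex" where
  "zeta_pow p y = cis (2 * pi / real p) ^ fp_index p y"

definition walsh :: "nat \<Rightarrow> nat \<Rightarrow> ('a::{field,finite} \<Rightarrow> 'a) \<Rightarrow> 'a \<Rightarrow> complex" where
  "walsh p k f b = (\<Sum>x\<in>UNIV. zeta_pow p (f x + abs_trace p k (b * x)))"

definition conditionA :: "nat \<Rightarrow> nat \<Rightarrow> ('a::{field,finite} \<Rightarrow> 'a) \<Rightarrow> int \<Rightarrow> bool" where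
  "conditionA p k f \<epsilon> \<longleftrightarrow>
     prime p \<and> odd p \<and> card (UNIV::'a set) = p ^ (2*k) \<and>
     (\<forall>x. f x \<in> prime_subfield p) \<and>
     f 0 = 0 \<and> (\<forall>x. f (-x) = f x) \<and>
     (\<exists>l::int. gcd (l - 1) (int p - 1) = 1 \<and>
        (\<forall>\<alpha>\<in>prime_subfield p. \<forall>x. f (\<alpha> * x) = \<alpha> powi l * f x)) \<and>
     \<epsilon> \<in> {1, -1} \<and>
     (\<exists>fstar::'a \<Rightarrow> 'a. (\<forall>b. fstar b \<in> prime_subfield p) \<and>
        (\<forall>b. walsh p k f b = of_int \<epsilon> * of_nat (p ^ k) * zeta_pow p (fstar b)))"

definition is_nonsquare_Fp :: "nat \<Rightarrow> 'a::field \<Rightarrow> bool" where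
  "is_nonsquare_Fp p y \<longleftrightarrow> y \<in> prime_subfield p \<and> \<not> (\<exists>z\<in>prime_subfield p. z ^ 2 = y)"

definition partial_difference_set ::
  "'a::{ab_group_add,finite} set \<Rightarrow> real \<Rightarrow> real \<Rightarrow> real \<Rightarrow> real \<Rightarrow> bool" where
  "partial_difference_set D v d lam mu \<longleftrightarrow>
     0 \<notin> D \<and> real (card (UNIV::'a set)) = v \<and> real (card D) = d \<and>
     (\<forall>g\<in>D. g \<noteq> 0 \<longrightarrow> real (card {(x, y). x \<in> D \<and> y \<in> D \<and> x - y = g}) = lam) \<and>
     (\<forall>g. g \<notin> D \<and> g \<noteq> 0 \<longrightarrow> real (card {(x, y). x \<in> D \<and> y \<in> D \<and> x - y = g}) = mu)"

end

theory Submission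
  imports Defs "HOL-Computational_Algebra.Computational_Algebra" "HOL-Library.Real_Mod"
    "HOL-Number_Theory.Residues"
begin

(*
  Notation: F is the prime field inside the field of order q = p^(2k), tr the absolute trace,
  chi b x = zeta^(tr (b x)) the additive characters and D_hat b = sum_{x in D} chi b x.
  The key fact is that D_hat takes only two values r, s on nonzero b.  Then
  D_hat(b)^2 = (r + s) D_hat(b) - r s for b <> 0, and Fourier inversion expresses the number of
  representations g = x - y (x, y in D) through |D|, r, s and whether g lies in D.
*)

section \<open>Cyclotomic independence of the p-th roots of unity\<close>

lemma map_poly_of_int_mult:
  "map_poly (of_int::int\<Rightarrow>'b::comm_ring_1) (P * Q) = map_poly of_int P * map_poly of_int Q"
  by (rule poly_eqI) (simp add: coeff_map_poly coeff_mult)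

lemma map_poly_of_int_add:
  "map_poly (of_int::int\<Rightarrow>'b::comm_ring_1) (P + Q) = map_poly of_int P + map_poly of_int Q"
  by (rule poly_eqI) (simp add: coeff_map_poly)

lemma map_poly_of_int_sum:
  "map_poly (of_int::int\<Rightarrow>'b::comm_ring_1) (sum g A) = (\<Sum>i\<in>A. map_poly of_int (g i))"
  by (rule poly_eqI) (simp add: coeff_map_poly coeff_sum)

text \<open>In such a factorisation
  exactly one constant coefficient, say that of \<open>A\<close>, is divisible by \<open>q\<close>; the first coefficient of
  \<open>A\<close> not divisible by \<open>q\<close> then produces a coefficient of \<open>\<Psi>\<close> below the top not divisible by
  \<open>q\<close>.\<close>

lemma eisenstein_factor:
  fixes A B \<Psi> :: "int poly" and q :: int
  assumes q: "prime q" and AB: "A * B = \<Psi>" and dB: "degree B \<ge> 1"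
    and low: "\<And>j. j < degree \<Psi> \<Longrightarrow> q dvd Polynomial.coeff \<Psi> j"
    and c0: "\<not> q^2 dvd Polynomial.coeff \<Psi> 0" and lc: "\<not> q dvd lead_coeff \<Psi>"
    and qA: "q dvd Polynomial.coeff A 0"
  shows False
proof -
  have nz: "A \<noteq> 0" "B \<noteq> 0" using AB lc dB by auto
  have degP: "degree \<Psi> = degree A + degree B"
    unfolding AB[symmetric] using nz by (simp add: degree_mult_eq)
  have "lead_coeff \<Psi> = lead_coeff A * lead_coeff B"
    unfolding AB[symmetric] by (simp add: lead_coeff_mult)
  hence nA: "\<not> q dvd lead_coeff A" using lc by auto
  have "Polynomial.coeff \<Psi> 0 = Polynomial.coeff A 0 * Polynomial.coeff B 0"
    unfolding AB[symmetric] by (simp add: coeff_mult)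
  hence nB0: "\<not> q dvd Polynomial.coeff B 0"
    using c0 mult_dvd_mono[OF qA] by (auto simp: power2_eq_square)
  define r where "r = (LEAST i. \<not> q dvd Polynomial.coeff A i)"
  have r1: "\<not> q dvd Polynomial.coeff A r" unfolding r_def by (rule LeastI[of _ "degree A"]) (use nA in auto)
  have r2: "\<And>i. i < r \<Longrightarrow> q dvd Polynomial.coeff A i" unfolding r_def using not_less_Least by blast
  have "r \<le> degree A" unfolding r_def by (rule Least_le) (use nA in auto)
  hence rlt: "r < degree \<Psi>" using degP dB by linarith
  have "Polynomial.coeff \<Psi> r = (\<Sum>i\<le>r. Polynomial.coeff A i * Polynomial.coeff B (r - i))"
    unfolding AB[symmetric] by (simp add: coeff_mult)
  also have "\<dots> = (\<Sum>i<r. Polynomial.coeff A i * Polynomial.coeff B (r - i))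
                   + Polynomial.coeff A r * Polynomial.coeff B 0"
    by (simp add: lessThan_Suc_atMost[symmetric])
  finally have eq: "Polynomial.coeff \<Psi> r = (\<Sum>i<r. Polynomial.coeff A i * Polynomial.coeff B (r - i))
                   + Polynomial.coeff A r * Polynomial.coeff B 0" .
  have "q dvd (\<Sum>i<r. Polynomial.coeff A i * Polynomial.coeff B (r - i))" by (rule dvd_sum) (simp add: r2)
  moreover have "q dvd Polynomial.coeff \<Psi> r" using low rlt by blast
  ultimately have "q dvd Polynomial.coeff A r * Polynomial.coeff B 0" using eq by (metis dvd_add_right_iff)
  thus False using q r1 nB0 by (simp add: prime_dvd_mult_iff)
qed

lemma eisenstein_criterion:
  fixes A B \<Psi> :: "int poly" and q :: int
  assumes q: "prime q" and AB: "A * B = \<Psi>" and dA: "degree A \<ge> 1" and dB: "degree B \<ge> 1"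
    and low: "\<And>j. j < degree \<Psi> \<Longrightarrow> q dvd Polynomial.coeff \<Psi> j"
    and c0: "\<not> q^2 dvd Polynomial.coeff \<Psi> 0" and lc: "\<not> q dvd lead_coeff \<Psi>"
  shows False
proof -
  have "A \<noteq> 0" "B \<noteq> 0" using dA dB by auto
  hence "degree \<Psi> \<ge> 1" using AB dA by (auto simp: degree_mult_eq)
  hence "q dvd Polynomial.coeff \<Psi> 0" using low by simp
  moreover have "Polynomial.coeff \<Psi> 0 = Polynomial.coeff A 0 * Polynomial.coeff B 0"
    unfolding AB[symmetric] by (simp add: coeff_mult)
  ultimately have "q dvd Polynomial.coeff A 0 * Polynomial.coeff B 0" by simp
  hence "q dvd Polynomial.coeff A 0 \<or> q dvd Polynomial.coeff B 0" using q by (simp add: prime_dvd_mult_iff)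
  moreover have "B * A = \<Psi>" using AB by (simp add: mult.commute)
  ultimately show False using eisenstein_factor[OF q AB dB low c0 lc] eisenstein_factor[OF q _ dA low c0 lc]
    by blast
qed

lemma pcompose_power: "pcompose (P ^ n) Q = (pcompose P Q) ^ n"
  by (induction n) (simp_all add: pcompose_1 pcompose_mult)

text \<open>The polynomial \<open>1 + X + \<dots> + X ^ (p - 1)\<close> and its shift by \<open>X \<mapsto> X + 1\<close>, to which Eisenstein's
  criterion applies.\<close>

definition cyclo :: "nat \<Rightarrow> int poly" where
  "cyclo p = (\<Sum>i<p. [:0, 1:] ^ i)"

definition cyclo_shift :: "nat \<Rightarrow> int poly" where
  "cyclo_shift p = pcompose (cyclo p) [:1, 1:]"

lemma cyclo_times_X_minus_1: "[:-1, 1:] * cyclo p = [:0, 1:] ^ p - 1"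
proof -
  have "[:0, 1:] ^ p - 1 = ([:0, 1:] - 1) * (\<Sum>i<p. [:0, 1::int:] ^ i)" by (rule power_diff_1_eq)
  moreover have "[:0, 1:] - 1 = [:-1, 1::int:]" by (simp add: one_pCons)
  ultimately show ?thesis by (simp add: cyclo_def)
qed

lemma cyclo_shift_times_X: "[:0, 1:] * cyclo_shift p = [:1, 1:] ^ p - 1"
proof -
  have "pcompose ([:-1, 1:] * cyclo p) [:1, 1:] = pcompose ([:0, 1:] ^ p - 1) [:1, 1::int:]"
    by (simp only: cyclo_times_X_minus_1)
  thus ?thesis
    by (simp add: pcompose_mult pcompose_diff pcompose_power pcompose_1 pcompose_pCons
        cyclo_shift_def one_pCons)
qed

lemma coeff_cyclo_shift:
  assumes "j < p" shows "Polynomial.coeff (cyclo_shift p) j = int (p choose (j + 1))"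
proof -
  have "Polynomial.coeff (cyclo_shift p) j = Polynomial.coeff ([:0, 1:] * cyclo_shift p) (Suc j)"
    by (simp add: coeff_pCons)
  also have "\<dots> = Polynomial.coeff ([:1, 1:] ^ p - 1) (Suc j)" by (simp only: cyclo_shift_times_X)
  also have "\<dots> = Polynomial.coeff ([:1, 1::int:] ^ p) (Suc j)" by simp
  also have "\<dots> = int (p choose Suc j)" using assms by (subst coeff_linear_poly_power) auto
  finally show ?thesis by simp
qed

lemma degree_cyclo: assumes "p \<ge> 1" shows "degree (cyclo p) = p - 1"
proof -
  have "[:0, 1::int:] ^ p = Polynomial.monom 1 p" by (simp add: monom_altdef)
  hence "[:0, 1::int:] ^ p - 1 = Polynomial.monom 1 p + (-1)" by simp
  moreover have "degree (Polynomial.monom (1::int) p + (-1)) = p"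
    using assms by (subst degree_add_eq_left) (auto simp: degree_monom_eq)
  ultimately have deg: "degree ([:-1, 1:] * cyclo p) = p" unfolding cyclo_times_X_minus_1 by simp
  hence "cyclo p \<noteq> 0" using assms by auto
  with deg show ?thesis by (subst (asm) degree_mult_eq) auto
qed

lemma lead_coeff_cyclo_shift: assumes "p \<ge> 1" shows "lead_coeff (cyclo_shift p) = 1"
  using assms coeff_cyclo_shift[of "p - 1" p]
  by (simp add: cyclo_shift_def degree_pcompose degree_cyclo)

text \<open>For prime \<open>p\<close> the shifted polynomial is Eisenstein at \<open>p\<close>: its coefficients below the top
  are the binomial coefficients \<open>p choose (j+1)\<close>.\<close>

lemma cyclo_irreducible:
  assumes pr: "prime p" shows "irreducible (cyclo p)"
proof -
  have p2: "p \<ge> 2" using pr prime_ge_2_nat by blast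
  have dc: "degree (cyclo p) = p - 1" using degree_cyclo p2 by auto
  have dcs: "degree (cyclo_shift p) = p - 1"
    using p2 by (simp add: cyclo_shift_def degree_pcompose degree_cyclo)
  have lcs: "lead_coeff (cyclo_shift p) = 1" using lead_coeff_cyclo_shift p2 by simp
  have lc: "lead_coeff (cyclo p) = 1"
  proof -
    have "lead_coeff (cyclo_shift p) = lead_coeff (cyclo p) * lead_coeff [:1, 1::int:] ^ degree (cyclo p)"
      unfolding cyclo_shift_def by (rule lead_coeff_comp) simp
    thus ?thesis using lcs by simp
  qed
  have prp: "prime (int p)" using pr by simp
  have low: "int p dvd Polynomial.coeff (cyclo_shift p) j" if "j < degree (cyclo_shift p)" for j
  proof -
    have j: "j + 1 < p" using that dcs by auto
    have "p dvd (p choose (j + 1))" by (rule dvd_choose_prime) (use j pr in auto)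
    thus ?thesis using coeff_cyclo_shift[of j p] j by simp
  qed
  have c0: "\<not> (int p)^2 dvd Polynomial.coeff (cyclo_shift p) 0"
  proof
    assume "(int p)^2 dvd Polynomial.coeff (cyclo_shift p) 0"
    hence "int p * int p dvd int p * 1" using coeff_cyclo_shift[of 0 p] p2 by (simp add: power2_eq_square)
    hence "int p dvd 1" using p2 by (subst (asm) dvd_times_left_cancel_iff) auto
    thus False using prp by (simp add: prime_int_iff)
  qed
  have lcn: "\<not> int p dvd lead_coeff (cyclo_shift p)" using lcs prp by (auto simp: prime_int_iff)
  show ?thesis
  proof (rule irreducibleI)
    show "cyclo p \<noteq> 0" using lc by auto
    show "\<not> is_unit (cyclo p)" using dc p2 by (auto simp: is_unit_poly_iff)
    fix a b assume ab: "cyclo p = a * b"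
    show "is_unit a \<or> is_unit b"
    proof (cases "degree a = 0 \<or> degree b = 0")
      case True
      have "lead_coeff a * lead_coeff b = 1" using lc ab by (simp add: lead_coeff_mult)
      hence "lead_coeff a dvd 1" "lead_coeff b dvd 1" by (metis dvdI mult.commute)+
      thus ?thesis using True by (metis degree_0_id is_unit_poly_iff)
    next
      case False
      have "pcompose a [:1, 1:] * pcompose b [:1, 1:] = cyclo_shift p"
        unfolding cyclo_shift_def ab by (simp add: pcompose_mult)
      from eisenstein_criterion[OF prp this _ _ low c0 lcn] False show ?thesis
        by (auto simp: degree_pcompose)
    qed
  qed
qed

text \<open>Let \<open>w\<close> be a root of \<open>cyclo p\<close>.  An integer polynomial \<open>Q\<close> of minimal degree among the
  nonzero ones vanishing at \<open>w\<close> is a multiple of \<open>cyclo p\<close>: pseudo-division of \<open>cyclo p\<close> by \<open>Q\<close>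
  leaves a vanishing remainder of smaller degree, hence \<open>0\<close>; as \<open>cyclo p\<close> is prime, it divides
  \<open>Q\<close> or the quotient, and the latter would make \<open>Q\<close> a nonzero constant.\<close>

lemma cyclo_dvd_minimal_vanishing:
  fixes w :: complex
  defines "E \<equiv> \<lambda>Q::int poly. poly (map_poly of_int Q) w"
  assumes pr: "prime p" and root: "E (cyclo p) = 0"
    and Q: "Q \<noteq> 0" "E Q = 0" and minimal: "\<And>R. R \<noteq> 0 \<Longrightarrow> E R = 0 \<Longrightarrow> degree Q \<le> degree R"
  shows "cyclo p dvd Q"
proof -
  obtain A R where qr: "pseudo_divmod (cyclo p) Q = (A, R)" by force
  define c where "c = Polynomial.coeff Q (degree Q) ^ (Suc (degree (cyclo p)) - degree Q)"
  have c0: "c \<noteq> 0" using Q(1) by (simp add: c_def)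
  have eq: "Polynomial.smult c (cyclo p) = Q * A + R"
    using pseudo_divmod(1)[OF Q(1) qr] by (simp add: c_def)
  have "E (Polynomial.smult c (cyclo p)) = of_int c * E (cyclo p)"
    by (simp add: E_def map_poly_smult)
  hence "E R = 0" using root Q(2) eq by (simp add: E_def map_poly_of_int_add map_poly_of_int_mult)
  hence R0: "R = 0" using pseudo_divmod(2)[OF Q(1) qr] minimal by fastforce
  have prc: "prime_elem (cyclo p)" using cyclo_irreducible[OF pr] by (rule irreducible_imp_prime_elem)
  have "cyclo p dvd Q * A" using eq R0 by (metis add.right_neutral dvd_smult dvd_refl)
  hence "cyclo p dvd Q \<or> cyclo p dvd A" using prc by (simp add: prime_elem_dvd_mult_iff)
  moreover have "\<not> cyclo p dvd A"
  proof
    assume "cyclo p dvd A"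
    then obtain B where B: "A = cyclo p * B" by (auto elim: dvdE)
    have "cyclo p \<noteq> 0" using prc by auto
    moreover have "[:c:] * cyclo p = (Q * B) * cyclo p" using eq R0 B by (simp add: mult_ac)
    ultimately have cQB: "[:c:] = Q * B" using mult_right_cancel by blast
    hence "degree (Q * B) = 0" by (metis degree_pCons_0)
    moreover have "B \<noteq> 0" using cQB c0 by auto
    ultimately have "degree Q = 0" using Q(1) by (simp add: degree_mult_eq)
    then obtain q0 where "Q = [:q0:]" by (meson degree_eq_zeroE)
    moreover have "map_poly (of_int::int\<Rightarrow>complex) [:q0:] = [:of_int q0:]"
      by (rule poly_eqI) (simp add: coeff_map_poly coeff_pCons split: nat.split)
    ultimately show False using Q by (simp add: E_def)
  qed
  ultimately show ?thesis by blast
qed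

lemma cyclo_root_min_degree:
  fixes w :: complex
  assumes pr: "prime p" and root: "poly (map_poly of_int (cyclo p)) w = 0"
    and P: "P \<noteq> 0" "poly (map_poly of_int P) w = 0"
  shows "degree P \<ge> p - 1"
proof -
  define S where "S = {Q. Q \<noteq> 0 \<and> poly (map_poly of_int Q) w = 0}"
  have "P \<in> S" using P by (simp add: S_def)
  then obtain Q where Q: "Q \<in> S" "\<And>R. R \<in> S \<Longrightarrow> degree Q \<le> degree R"
    using ex_has_least_nat[of "\<lambda>Q. Q \<in> S" P degree] by blast
  have "cyclo p dvd Q"
    by (rule cyclo_dvd_minimal_vanishing[OF pr root]) (use Q in \<open>auto simp: S_def\<close>)
  hence "degree (cyclo p) \<le> degree Q" using Q(1) by (intro dvd_imp_degree_le) (auto simp: S_def)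
  moreover have "degree Q \<le> degree P" using Q(2) \<open>P \<in> S\<close> by blast
  ultimately show ?thesis using degree_cyclo[of p] pr prime_ge_1_nat by fastforce
qed

definition zeta :: "nat \<Rightarrow> complex" where "zeta p = cis (2 * pi / real p)"

lemma zeta_pow: "zeta p ^ i = cis (2 * pi * real i / real p)"
proof -
  have "real i * (2 * pi / real p) = 2 * pi * real i / real p" by simp
  thus ?thesis unfolding zeta_def DeMoivre by metis
qed

lemma zeta_pow_eq_1: assumes "p > 0" shows "zeta p ^ i = 1 \<longleftrightarrow> p dvd i"
proof
  assume "zeta p ^ i = 1"
  then obtain n where "2 * pi * real i / real p = of_int n * (2 * pi)"
    by (auto simp: zeta_pow cis_eq_1_iff)
  hence "real i = of_int n * real p" using assms by (simp add: field_simps)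
  hence "int i = n * int p" by (metis of_int_eq_iff of_int_mult of_int_of_nat_eq)
  thus "p dvd i" by (metis dvd_triv_right int_dvd_int_iff)
next
  assume "p dvd i"
  then obtain n where "i = p * n" by auto
  thus "zeta p ^ i = 1" using assms by (simp add: zeta_pow cis_eq_1_iff) (rule exI[of _ "int n"], simp)
qed

lemma zeta_pow_mod: assumes "p > 0" shows "zeta p ^ i = zeta p ^ (i mod p)"
proof -
  have "zeta p ^ i = zeta p ^ (p * (i div p) + i mod p)" by simp
  also have "\<dots> = zeta p ^ (i mod p)"
    using zeta_pow_eq_1[OF assms, of p] by (simp only: power_add power_mult) simp
  finally show ?thesis .
qed

lemma sum_zeta_pow:
  assumes "p > 0" shows "(\<Sum>i<p. (zeta p ^ m) ^ i) = (if p dvd m then of_nat p else 0)"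
proof (cases "p dvd m")
  case True
  hence "zeta p ^ m = 1" using zeta_pow_eq_1[OF assms] by simp
  thus ?thesis using True by simp
next
  case False
  have "(zeta p ^ m) ^ p - 1 = (zeta p ^ m - 1) * (\<Sum>i<p. (zeta p ^ m) ^ i)" by (rule power_diff_1_eq)
  moreover have "(zeta p ^ m) ^ p = 1"
    using zeta_pow_eq_1[OF assms, of "m * p"] by (simp add: power_mult)
  ultimately show ?thesis using zeta_pow_eq_1[OF assms] False by simp
qed

text \<open>Cyclotomic independence: an integer relation among \<open>1, zeta, \<dots>, zeta ^ (p - 1)\<close> has all
  coefficients equal (otherwise subtracting the last coefficient times \<open>cyclo p\<close> gives a
  nonzero relation of degree \<open>< p - 1\<close>).\<close>

lemma zeta_relation_const:
  assumes pr: "prime p" and rel: "(\<Sum>i<p. of_int (a i) * zeta p ^ i) = 0"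
  shows "\<forall>i<p. a i = a (p - 1)"
proof -
  have p0: "p > 0" "\<not> p dvd 1" using pr prime_gt_0_nat by (blast, simp add: prime_nat_iff)
  have sum1: "(\<Sum>i<p. zeta p ^ i) = 0" using sum_zeta_pow[OF p0(1), of 1] p0(2) by simp
  have root: "poly (map_poly of_int (cyclo p)) (zeta p) = 0"
  proof -
    have "cyclo p = (\<Sum>i<p. Polynomial.monom 1 i)" by (simp add: cyclo_def monom_altdef)
    thus ?thesis using sum1 by (simp add: map_poly_of_int_sum map_poly_monom poly_monom poly_sum)
  qed
  define P where "P = (\<Sum>i<p. Polynomial.monom (a i - a (p - 1)) i)"
  have cP: "Polynomial.coeff P j = (if j < p then a j - a (p - 1) else 0)" for j
    by (simp add: P_def coeff_sum coeff_monom)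
  have "poly (map_poly of_int P) (zeta p) = (\<Sum>i<p. of_int (a i - a (p - 1)) * zeta p ^ i)"
    by (simp add: P_def map_poly_of_int_sum map_poly_monom poly_monom poly_sum)
  also have "\<dots> = (\<Sum>i<p. of_int (a i) * zeta p ^ i) - of_int (a (p - 1)) * (\<Sum>i<p. zeta p ^ i)"
    by (simp add: algebra_simps sum_subtractf sum_distrib_left sum_distrib_right)
  also have "\<dots> = 0" using rel sum1 by simp
  finally have P0: "poly (map_poly of_int P) (zeta p) = 0" .
  have "degree P \<le> p - 2"
  proof (rule degree_le, intro allI impI)
    fix i assume "p - 2 < i"
    hence "i < p \<Longrightarrow> i = p - 1" using prime_ge_2_nat[OF pr] by linarith
    thus "Polynomial.coeff P i = 0" by (auto simp: cP)
  qed
  hence "P = 0" using cyclo_root_min_degree[OF pr root _ P0] prime_ge_2_nat[OF pr] by fastforce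
  thus ?thesis using cP by (metis coeff_0 eq_iff_diff_eq_0)
qed

section \<open>The prime subfield and the absolute trace\<close>

lemma power_card_UNIV_eq: "(x::'a::{field,finite}) ^ card (UNIV :: 'a set) = x"
proof (cases "x = 0")
  case False
  have "x * (\<Prod>y\<in>UNIV-{0}. x * y) = x * x ^ (card (UNIV :: 'a set) - 1) * \<Prod>(UNIV-{0})"
    by (simp add: prod.distrib mult_ac)
  also have "x * x ^ (card (UNIV :: 'a set) - 1) = x ^ Suc (card (UNIV :: 'a set) - 1)"
    by (subst power_Suc) auto
  also have "Suc (card (UNIV :: 'a set) - 1) = card (UNIV :: 'a set)"
    using finite_UNIV_card_ge_0[where ?'a = 'a] by simp
  also have "(\<Prod>y\<in>UNIV-{0}. x * y) = (\<Prod>y\<in>UNIV-{0}. y)"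
    by (rule prod.reindex_bij_witness[of _ "\<lambda>y. y / x" "\<lambda>y. x * y"]) (use False in auto)
  finally show ?thesis by simp
qed (use finite_UNIV_card_ge_0[where ?'a = 'a] in auto)

locale field_p2k =
  fixes p k :: nat
  assumes prime_p: "prime p" and card_UNIV: "card (UNIV::'a::{field,finite} set) = p ^ (2*k)"
begin

abbreviation F where "F \<equiv> (prime_subfield p :: 'a set)"
abbreviation Fs where "Fs \<equiv> F - {0}"
abbreviation tr where "tr \<equiv> (abs_trace p k :: 'a \<Rightarrow> 'a)"
abbreviation zp where "zp \<equiv> (zeta_pow p :: 'a \<Rightarrow> complex)"
abbreviation chi where "chi b x \<equiv> zp (tr (b * x))"

lemma p_gt0: "p > 0" using prime_p prime_gt_0_nat by blast
lemma p_ge2: "p \<ge> 2" using prime_p prime_ge_2_nat by blast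

lemma CHAR_eq: "CHAR('a) = p"
proof -
  have "CHAR('a) > 0" by (rule finite_imp_CHAR_pos) simp
  hence prC: "prime CHAR('a)" by (rule prime_CHAR_semidom)
  have "CHAR('a) dvd p ^ (2*k)" using CHAR_dvd_CARD[where 'a='a] card_UNIV by simp
  hence "CHAR('a) dvd p" using prC prime_dvd_power by blast
  thus ?thesis using prC prime_p by (simp add: primes_dvd_imp_eq)
qed

lemma of_nat_eq_iff: "(of_nat i :: 'a) = of_nat j \<longleftrightarrow> i mod p = j mod p"
  using of_nat_eq_iff_cong_CHAR[where 'a='a, of i j] CHAR_eq by (simp add: cong_def)

lemma of_nat_eq_0_iff: "(of_nat i :: 'a) = 0 \<longleftrightarrow> p dvd i"
  using of_nat_eq_0_iff_char_dvd[where 'a='a] CHAR_eq by simp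

lemma of_nat_mod: "(of_nat (i mod p) :: 'a) = of_nat i" using of_nat_eq_iff by simp

lemma k_ge1: "k \<ge> 1"
proof (rule ccontr)
  assume "\<not> k \<ge> 1"
  hence "card (UNIV::'a set) = 1" using card_UNIV by simp
  then obtain a where "(UNIV::'a set) = {a}" using card_1_singletonE by blast
  hence "(0::'a) = 1" by (metis UNIV_I singletonD)
  thus False by simp
qed

lemma F_eq: "F = range of_nat"
proof -
  have "range (of_nat::nat\<Rightarrow>'a) \<subseteq> F"
    by (auto simp: prime_subfield_def) (metis of_nat_mod mod_less_divisor p_gt0)
  thus ?thesis by (auto simp: prime_subfield_def)
qed

lemma F_image: "F = of_nat ` {..<p}" by (auto simp: prime_subfield_def)

lemma F_cases: assumes "y \<in> F" obtains i where "i < p" "y = of_nat i"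
  using assms unfolding prime_subfield_def by auto

lemma of_nat_in_F [simp, intro]: "of_nat n \<in> F" by (simp add: F_eq)
lemma zero_in_F [simp, intro]: "0 \<in> F" using of_nat_in_F[of 0] by simp
lemma one_in_F [simp, intro]: "1 \<in> F" using of_nat_in_F[of 1] by simp

lemma F_add [simp, intro]: "a \<in> F \<Longrightarrow> b \<in> F \<Longrightarrow> a + b \<in> F"
  by (auto simp: F_eq) (metis of_nat_add rangeI)

lemma F_mult [simp, intro]: "a \<in> F \<Longrightarrow> b \<in> F \<Longrightarrow> a * b \<in> F"
  by (auto simp: F_eq) (metis of_nat_mult rangeI)

lemma F_uminus [simp, intro]: assumes "a \<in> F" shows "- a \<in> F"
proof -
  obtain i where i: "a = of_nat i" using assms by (auto simp: F_eq)
  have "i + (p * i - i) = p * i" using p_gt0 by simp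
  hence "a + of_nat (p * i - i) = of_nat (p * i)" unfolding i by (metis of_nat_add)
  hence "- a = of_nat (p * i - i)" by (simp add: of_nat_eq_0_iff minus_unique)
  thus ?thesis by simp
qed

lemma F_diff [simp, intro]: "a \<in> F \<Longrightarrow> b \<in> F \<Longrightarrow> a - b \<in> F"
  using F_add F_uminus by (metis diff_conv_add_uminus)

lemma F_power [simp, intro]: "a \<in> F \<Longrightarrow> a ^ n \<in> F"
  by (induction n) auto

lemma inj_on_of_nat_F: "inj_on (of_nat :: nat \<Rightarrow> 'a) {..<p}"
  by (rule inj_onI) (simp add: of_nat_eq_iff)

lemma card_F: "card F = p"
  using card_image[OF inj_on_of_nat_F] F_image by simp

lemma card_Fs: "card Fs = p - 1" using card_F by (simp add: card_Diff_singleton)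

lemma sum_F: "(\<Sum>y\<in>F. g y) = (\<Sum>i<p. g (of_nat i))"
  using sum.reindex[OF inj_on_of_nat_F, of g] F_image by simp

lemma frobenius_F: assumes "a \<in> F" shows "a ^ p = a"
proof -
  obtain i where i: "a = of_nat i" using assms by (auto simp: F_eq)
  have "(of_nat i :: 'a) ^ p = of_nat i"
  proof (induction i)
    case (Suc i)
    have "(of_nat (Suc i) :: 'a) ^ p = (of_nat i + 1) ^ p" by (simp add: add.commute)
    also have "\<dots> = of_nat i ^ p + 1 ^ p" by (rule freshmans_dream) (simp_all add: CHAR_eq prime_p)
    finally show ?case using Suc by simp
  qed (use p_gt0 in simp)
  thus ?thesis using i by simp
qed

lemma frobenius_F_power: "a \<in> F \<Longrightarrow> a ^ (p ^ n) = a"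
  by (induction n) (simp_all add: power_Suc power_mult frobenius_F mult.commute)

lemma fermat_F: assumes w: "w \<in> Fs" shows "w ^ (p - 1) = 1"
proof -
  have "p = Suc (p - 1)" using p_gt0 by simp
  hence "w ^ (p - 1) * w = w" using frobenius_F w by (metis power_Suc2 DiffD1)
  thus ?thesis using w by (simp add: mult_cancel_right2)
qed

lemma F_inverse [simp, intro]: assumes a: "a \<in> F" shows "inverse a \<in> F"
proof (cases "a = 0")
  case False
  have "p - 1 = Suc (p - 2)" using p_ge2 by simp
  hence "a * a ^ (p - 2) = 1" using fermat_F[of a] a False by (simp add: power_Suc2 mult.commute)
  hence "inverse a = a ^ (p - 2)" by (metis inverse_unique)
  thus ?thesis using a by simp
qed simp

lemma F_divide [simp, intro]: "a \<in> F \<Longrightarrow> b \<in> F \<Longrightarrow> a / b \<in> F"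
  by (simp add: divide_inverse)

lemma roots_X_pow_p_minus_X: "{y::'a. y ^ p = y} = F"
proof -
  define P :: "'a poly" where "P = Polynomial.monom 1 p + [:0, -1:]"
  have P: "poly P y = y ^ p - y" for y by (simp add: P_def poly_monom)
  have degP: "degree P = p" unfolding P_def using p_ge2
    by (subst degree_add_eq_left) (auto simp: degree_monom_eq)
  hence "card {y. poly P y = 0} \<le> p" using card_poly_roots_bound p_ge2 by (metis degree_0 not_numeral_le_zero)
  hence c: "card {y::'a. y ^ p = y} \<le> p" by (simp add: P)
  have sub: "F \<subseteq> {y. y ^ p = y}" using frobenius_F by auto
  show ?thesis by (rule card_seteq[OF _ sub, symmetric]) (use c card_F in auto)
qed

lemma power_bij_Fs:
  assumes cop: "coprime e (p - 1)"
  shows "inj_on (\<lambda>t. t ^ e) Fs" "(\<lambda>t. t ^ e) ` Fs = Fs"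
proof -
  have one: "w = 1" if w: "w \<in> Fs" "w ^ e = 1" for w
  proof -
    show "w = 1"
    proof (cases "e = 0")
      case True
      thus ?thesis using cop fermat_F[OF w(1)] by simp
    next
      case False
      then obtain x y where "e * x = (p - 1) * y + gcd e (p - 1)" using bezout_nat by blast
      hence "w ^ (e * x) = w ^ ((p - 1) * y) * w" using cop by (simp add: power_add)
      thus "w = 1" using w(2) fermat_F[OF w(1)] by (simp add: power_mult)
    qed
  qed
  show inj: "inj_on (\<lambda>t. t ^ e) Fs"
  proof (rule inj_onI)
    fix s t assume st: "s \<in> Fs" "t \<in> Fs" "s ^ e = t ^ e"
    have "(s / t) ^ e = 1" using st by (simp add: power_divide)
    moreover have "s / t \<in> Fs" using st by auto
    ultimately have "s / t = 1" using one by blast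
    thus "s = t" using st by simp
  qed
  have "(\<lambda>t. t ^ e) ` Fs \<subseteq> Fs" by auto
  thus "(\<lambda>t. t ^ e) ` Fs = Fs" by (rule card_subset_eq[rotated]) (use card_image[OF inj] in auto)
qed

lemma fp_index_of_nat: "fp_index p (of_nat n :: 'a) = n mod p"
proof -
  have "\<exists>!i. i < p \<and> (of_nat i :: 'a) = of_nat n"
    by (rule ex1I[of _ "n mod p"]) (auto simp: of_nat_eq_iff p_gt0)
  hence "(THE i. i < p \<and> (of_nat i :: 'a) = of_nat n) = n mod p"
    by (rule the1_equality) (auto simp: of_nat_eq_iff p_gt0)
  thus ?thesis by (simp add: fp_index_def)
qed

lemma zp_of_nat: "zp (of_nat n) = zeta p ^ n"
  by (simp add: zeta_pow_def fp_index_of_nat zeta_def[symmetric] zeta_pow_mod[OF p_gt0, symmetric])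

lemma zp_0 [simp]: "zp 0 = 1" using zp_of_nat[of 0] by simp

lemma zp_add: "a \<in> F \<Longrightarrow> b \<in> F \<Longrightarrow> zp (a + b) = zp a * zp b"
  by (auto simp: F_eq zp_of_nat power_add simp flip: of_nat_add)

lemma zeta_ne_1: "zeta p \<noteq> 1"
  using zeta_pow_eq_1[OF p_gt0, of 1] p_ge2 by auto

lemma sum_F_zp_mult:
  assumes c: "c \<in> F" shows "(\<Sum>u\<in>F. zp (u * c)) = (if c = 0 then of_nat p else 0)"
proof -
  obtain m where m: "c = of_nat m" using c by (auto simp: F_eq)
  have "(\<Sum>u\<in>F. zp (u * c)) = (\<Sum>i<p. (zeta p ^ m) ^ i)"
    by (simp add: sum_F m zp_of_nat flip: of_nat_mult power_mult) (simp add: mult.commute)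
  also have "\<dots> = (if p dvd m then of_nat p else 0)" by (rule sum_zeta_pow[OF p_gt0])
  finally show ?thesis by (simp add: m of_nat_eq_0_iff)
qed

lemma sum_Fs_zp_mult:
  assumes "c \<in> F" shows "(\<Sum>s\<in>Fs. zp (s * c)) = (if c = 0 then of_nat p else 0) - 1"
proof -
  have "(\<Sum>s\<in>F. zp (s * c)) = zp (0 * c) + (\<Sum>s\<in>Fs. zp (s * c))"
    by (rule sum.remove) auto
  thus ?thesis using sum_F_zp_mult[OF assms] by simp
qed

lemma frobenius_add: "((x::'a) + y) ^ (p ^ n) = x ^ (p ^ n) + y ^ (p ^ n)"
  by (rule freshmans_dream') (simp_all add: CHAR_eq prime_p)

lemma tr_add: "tr (x + y) = tr x + tr y"
  by (simp add: abs_trace_def frobenius_add sum.distrib)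

lemma tr_scale: "c \<in> F \<Longrightarrow> tr (c * x) = c * tr x"
  by (simp add: abs_trace_def power_mult_distrib frobenius_F_power sum_distrib_left)

lemma tr_0 [simp]: "tr 0 = 0" using tr_scale[of 0 0] by simp

text \<open>The trace is invariant under Frobenius, since \<open>x ^ p ^ (2 k) = x\<close>; hence it takes values in \<open>F\<close>.\<close>

lemma tr_power_p: "tr x ^ p = tr x"
proof -
  obtain m where m: "2*k = Suc m" using k_ge1 by (metis Suc_pred' mult_pos_pos zero_less_numeral less_le_trans zero_less_one)
  have "tr x ^ p = (\<Sum>i<2*k. (x ^ (p ^ i)) ^ p)"
    unfolding abs_trace_def by (rule freshmans_dream_sum) (simp_all add: CHAR_eq prime_p)
  also have "\<dots> = (\<Sum>i<Suc m. x ^ (p ^ Suc i))"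
    unfolding m by (rule sum.cong) (simp_all only: power_Suc2 power_mult)
  also have "\<dots> = (\<Sum>i<m. x ^ (p ^ Suc i)) + x ^ (p ^ Suc m)" by simp
  also have "x ^ (p ^ Suc m) = x" using power_card_UNIV_eq[of x] card_UNIV m by simp
  also have "(\<Sum>i<m. x ^ (p ^ Suc i)) + x = (\<Sum>i<Suc m. x ^ (p ^ i))"
    by (simp only: sum.lessThan_Suc_shift) simp
  finally show ?thesis by (simp add: abs_trace_def m)
qed

lemma tr_in_F [simp, intro]: "tr x \<in> F"
  using tr_power_p roots_X_pow_p_minus_X by blast

text \<open>The trace is a polynomial of degree \<open>p ^ (2 k - 1)\<close>, fewer than the field order, so it is not
  identically zero.\<close>

lemma coeff_trace_poly:
  "Polynomial.coeff (\<Sum>i<n. Polynomial.monom (1::'a) (p ^ i)) j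
     = (if j \<in> (\<lambda>i. p ^ i) ` {..<n} then 1 else 0)"
proof (cases "j \<in> (\<lambda>i. p ^ i) ` {..<n}")
  case True
  then obtain i0 where i0: "i0 < n" "j = p ^ i0" by auto
  have "(\<Sum>i<n. Polynomial.coeff (Polynomial.monom (1::'a) (p ^ i)) j)
      = (\<Sum>i\<in>{i0}. Polynomial.coeff (Polynomial.monom (1::'a) (p ^ i)) j)"
    by (rule sum.mono_neutral_right) (use i0 p_ge2 in \<open>auto simp: power_inject_exp coeff_monom\<close>)
  thus ?thesis using True i0 by (simp add: coeff_sum)
qed (auto simp: coeff_sum coeff_monom intro!: sum.neutral)

lemma tr_nonzero: "\<exists>x. tr x \<noteq> 0"
proof (rule ccontr)
  assume "\<not> (\<exists>x. tr x \<noteq> 0)"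
  define T :: "'a poly" where "T = (\<Sum>i<2*k. Polynomial.monom 1 (p ^ i))"
  have roots: "{x. poly T x = 0} = UNIV"
    using \<open>\<not> (\<exists>x. tr x \<noteq> 0)\<close> by (auto simp: T_def poly_sum poly_monom abs_trace_def)
  have "Polynomial.coeff T 1 = 1"
    using k_ge1 by (auto simp: T_def coeff_trace_poly image_iff intro: bexI[of _ 0])
  hence Tnz: "T \<noteq> 0" by auto
  have "degree T \<le> p ^ (2*k - 1)"
  proof (rule degree_le, intro allI impI)
    fix j assume j: "p ^ (2*k - 1) < j"
    have "\<forall>i<2*k. p ^ i \<le> p ^ (2*k - 1)" using p_ge2 by (auto intro: power_increasing)
    hence "j \<notin> (\<lambda>i. p ^ i) ` {..<2*k}" using j by fastforce
    thus "Polynomial.coeff T j = 0" by (simp add: T_def coeff_trace_poly)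
  qed
  also have "\<dots> < p ^ (2*k)" using p_ge2 k_ge1 by (intro power_strict_increasing) auto
  finally have "degree T < card (UNIV::'a set)" using card_UNIV by simp
  moreover have "card {x. poly T x = 0} \<le> degree T" by (rule card_poly_roots_bound[OF Tnz])
  ultimately show False using roots by simp
qed

lemma exists_tr_eq_1: assumes "b \<noteq> 0" shows "\<exists>x0. tr (b * x0) = 1"
proof -
  obtain x1 where x1: "tr x1 \<noteq> 0" using tr_nonzero by blast
  have "tr (b * (x1 / (b * tr x1))) = tr (inverse (tr x1) * x1)" using assms by (simp add: field_simps)
  also have "\<dots> = 1" using x1 by (subst tr_scale) auto
  finally show ?thesis by blast
qed

lemma chi_add: "chi b (x + y) = chi b x * chi b y"
  by (simp add: distrib_left tr_add zp_add)

lemma sum_chi: "(\<Sum>x\<in>UNIV. chi b x) = (if b = 0 then of_nat (card (UNIV::'a set)) else 0)"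
proof (cases "b = 0")
  case False
  obtain x0 where x0: "tr (b * x0) = 1" using exists_tr_eq_1[OF False] by blast
  have "(\<Sum>x\<in>UNIV. chi b x) = (\<Sum>x\<in>UNIV. chi b (x + x0))"
    by (rule sum.reindex_bij_witness[of _ "\<lambda>x. x + x0" "\<lambda>x. x - x0"]) auto
  also have "\<dots> = (\<Sum>x\<in>UNIV. chi b x) * zeta p"
    by (simp add: chi_add x0 zp_of_nat[of 1, simplified] sum_distrib_right)
  finally have "(\<Sum>x\<in>UNIV. chi b x) * (zeta p - 1) = 0" by (simp add: algebra_simps)
  thus ?thesis using zeta_ne_1 False by simp
qed simp

lemma sum_chi_dual: "(\<Sum>b\<in>UNIV. chi b x) = (if x = 0 then of_nat (card (UNIV::'a set)) else 0)"
  using sum_chi[of x] by (simp add: mult.commute)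

end

section \<open>The quadratic character of \<open>F\<close> and its Gauss sum\<close>

locale odd_field_p2k = field_p2k +
  assumes odd_p: "odd p"
begin

lemma p_ge3: "p \<ge> 3" using p_ge2 odd_p by presburger

lemma two_ne_0: "(2::'a) \<noteq> 0"
  using of_nat_eq_0_iff[of 2] p_ge3 by (auto dest: dvd_imp_le)

lemma square_eq_iff: "(z::'a)^2 = w^2 \<longleftrightarrow> z = w \<or> z = - w"
proof -
  have "z^2 - w^2 = (z - w) * (z + w)" by (simp add: power2_eq_square algebra_simps)
  thus ?thesis by (metis add_eq_0_iff2 eq_iff_diff_eq_0 mult_eq_0_iff neg_equal_iff_equal)
qed

lemma neg_ne_self: "(w::'a) \<noteq> 0 \<Longrightarrow> w \<noteq> - w"
  using two_ne_0 by (metis add_eq_0_iff2 mult_2 mult_eq_0_iff)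

definition is_sq :: "'a \<Rightarrow> bool" where "is_sq y \<longleftrightarrow> (\<exists>z\<in>F. z^2 = y)"
definition eta :: "'a \<Rightarrow> int" where "eta y = (if y = 0 then 0 else if is_sq y then 1 else -1)"
definition Sq where "Sq = {y\<in>F. y \<noteq> 0 \<and> is_sq y}"
definition NSq where "NSq = {y\<in>F. \<not> is_sq y}"

lemma finite_Sq [simp]: "finite Sq" by (simp add: Sq_def)
lemma finite_NSq [simp]: "finite NSq" by (simp add: NSq_def)

lemma is_sq_0 [simp]: "is_sq 0" by (auto simp: is_sq_def intro!: bexI[of _ 0])
lemma is_sq_square: "z \<in> F \<Longrightarrow> is_sq (z^2)" by (auto simp: is_sq_def)

text \<open>Squaring is two-to-one on \<open>F\<^sup>*\<close>, so half of \<open>F\<^sup>*\<close> are squares.\<close>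

lemma card_Sq: "2 * card Sq = p - 1"
proof -
  define A where "A y = {z\<in>Fs. z^2 = y}" for y
  have fibre: "card (A y) = 2" if y: "y \<in> Sq" for y
  proof -
    obtain w where w: "w \<in> F" "w^2 = y" using y by (auto simp: Sq_def is_sq_def)
    have w0: "w \<noteq> 0" using w y by (auto simp: Sq_def)
    have "A y = {w, -w}" using w w0 by (auto simp: A_def square_eq_iff)
    thus ?thesis using neg_ne_self[OF w0] by simp
  qed
  have "Fs = (\<Union>y\<in>Sq. A y)" by (auto simp: Sq_def is_sq_square A_def)
  moreover have "card (\<Union>y\<in>Sq. A y) = (\<Sum>y\<in>Sq. card (A y))"
    by (rule card_UN_disjoint) (auto simp: A_def)
  ultimately have "card Fs = (\<Sum>y\<in>Sq. card (A y))" by simp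
  also have "\<dots> = (\<Sum>y\<in>Sq. 2)" using fibre by simp
  finally show ?thesis using card_Fs by simp
qed

lemma card_NSq: "2 * card NSq = p - 1"
proof -
  have "NSq = Fs - Sq" "Sq \<subseteq> Fs" by (auto simp: NSq_def Sq_def)
  hence "card NSq = card Fs - card Sq" by (simp add: card_Diff_subset)
  thus ?thesis using card_Sq card_Fs by simp
qed

lemma not_is_sq_mult_sq:
  assumes n: "n \<in> F" "\<not> is_sq n" and s: "s \<in> F" "s \<noteq> 0" "is_sq s"
  shows "\<not> is_sq (n * s)"
proof
  assume "is_sq (n * s)"
  then obtain z where z: "z \<in> F" "z^2 = n * s" by (auto simp: is_sq_def)
  obtain w where w: "w \<in> F" "w^2 = s" using s by (auto simp: is_sq_def)
  have "(z / w)^2 = n * s / s" using z w by (simp add: power_divide)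
  also have "\<dots> = n" using s by simp
  finally show False using n z w by (metis F_divide is_sq_def)
qed

lemma NSq_image: assumes n: "n \<in> NSq" shows "NSq = (\<lambda>s. n * s) ` Sq"
proof -
  have n': "n \<in> F" "\<not> is_sq n" "n \<noteq> 0" using n by (auto simp: NSq_def)
  have sub: "(\<lambda>s. n * s) ` Sq \<subseteq> NSq"
    using not_is_sq_mult_sq[OF n'(1,2)] n' by (auto simp: Sq_def NSq_def)
  have "card ((\<lambda>s. n * s) ` Sq) = card Sq"
    by (rule card_image) (use n' in \<open>auto intro: inj_onI\<close>)
  also have "\<dots> = card NSq" using card_Sq card_NSq by simp
  finally show ?thesis using card_subset_eq[OF finite_NSq sub] by simp
qed

lemma is_sq_mult: "is_sq a \<Longrightarrow> is_sq b \<Longrightarrow> is_sq (a * b)"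
  by (auto simp: is_sq_def) (metis F_mult power_mult_distrib)

lemma is_sq_mult_NSq: assumes "a \<in> NSq" "b \<in> NSq" shows "is_sq (a * b)"
proof -
  obtain s where s: "s \<in> Sq" "b = a * s" using NSq_image[OF assms(1)] assms(2) by auto
  have "a * b = a^2 * s" using s by (simp add: power2_eq_square)
  thus ?thesis using s assms(1) by (metis NSq_def mem_Collect_eq is_sq_square is_sq_mult Sq_def)
qed

lemma eta_mult: assumes "a \<in> F" "b \<in> F" shows "eta (a * b) = eta a * eta b"
proof (cases "a = 0 \<or> b = 0")
  case False
  have "is_sq (a * b) \<longleftrightarrow> (is_sq a \<longleftrightarrow> is_sq b)"
    using is_sq_mult is_sq_mult_NSq not_is_sq_mult_sq[of a b] not_is_sq_mult_sq[of b a] assms False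
    by (auto simp: NSq_def mult.commute)
  thus ?thesis using False by (simp add: eta_def)
qed (auto simp: eta_def)

lemma eta_1 [simp]: "eta 1 = 1" by (auto simp: eta_def is_sq_def intro!: bexI[of _ 1])

lemma eta_power: "a \<in> F \<Longrightarrow> eta (a ^ n) = eta a ^ n"
  by (induction n) (simp_all add: eta_mult)

lemma eta_inverse: assumes "a \<in> F" shows "eta (inverse a) = eta a"
proof (cases "a = 0")
  case False
  have "eta (inverse a) * eta a = 1" using assms False by (simp flip: eta_mult)
  thus ?thesis using False by (simp add: eta_def split: if_splits)
qed simp

lemma eta_pm1: "a \<in> Fs \<Longrightarrow> eta a = 1 \<or> eta a = -1" by (simp add: eta_def)

lemma sum_eta: "(\<Sum>y\<in>F. of_int (eta y)) = (0::complex)"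
proof -
  have F: "F = {0} \<union> Sq \<union> NSq" by (auto simp: Sq_def NSq_def)
  have "(\<Sum>y\<in>F. eta y) = (\<Sum>y\<in>{0}. eta y) + (\<Sum>y\<in>Sq. eta y) + (\<Sum>y\<in>NSq. eta y)"
    unfolding F by (subst sum.union_disjoint; auto simp: Sq_def NSq_def)+
  also have "(\<Sum>y\<in>Sq. eta y) = int (card Sq)" by (simp add: eta_def Sq_def)
  also have "(\<Sum>y\<in>NSq. eta y) = (\<Sum>y\<in>NSq. -1)" by (rule sum.cong) (auto simp: eta_def NSq_def)
  finally have "(\<Sum>y\<in>F. eta y) = 0" using card_Sq card_NSq by (simp add: eta_def)
  thus ?thesis by (metis of_int_0 of_int_sum)
qed

definition gauss :: complex where "gauss = (\<Sum>y\<in>F. of_int (eta y) * zp y)"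

lemma gauss_scale:
  assumes a: "a \<in> F" shows "(\<Sum>y\<in>F. of_int (eta y) * zp (a * y)) = of_int (eta a) * gauss"
proof (cases "a = 0")
  case True thus ?thesis using sum_eta by (simp add: eta_def)
next
  case False
  have "(\<Sum>y\<in>F. of_int (eta y) * zp (a * y)) = (\<Sum>w\<in>F. of_int (eta (w / a)) * zp w)"
    by (rule sum.reindex_bij_witness[of _ "\<lambda>w. w / a" "\<lambda>y. a * y"]) (use a False in auto)
  also have "\<dots> = (\<Sum>w\<in>F. of_int (eta a) * (of_int (eta w) * zp w))"
  proof (rule sum.cong)
    fix w assume w: "w \<in> F"
    have "eta (w / a) = eta w * eta a" using w a by (simp add: divide_inverse eta_mult eta_inverse)
    thus "of_int (eta (w / a)) * zp w = of_int (eta a) * (of_int (eta w) * zp w)" by simp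
  qed simp
  also have "\<dots> = of_int (eta a) * gauss" by (simp add: gauss_def sum_distrib_left)
  finally show ?thesis .
qed

lemma gauss_square: "gauss * gauss = of_int (eta (-1)) * of_nat p"
proof -
  have "gauss * gauss = (\<Sum>s\<in>F. zp s * (of_int (eta s) * gauss))"
    by (simp add: gauss_def sum_distrib_right mult_ac)
  also have "\<dots> = (\<Sum>s\<in>F. zp s * (\<Sum>t\<in>F. of_int (eta t) * zp (s * t)))"
    by (rule sum.cong) (simp_all add: gauss_scale)
  also have "\<dots> = (\<Sum>s\<in>F. \<Sum>t\<in>F. of_int (eta t) * zp (s * (1 + t)))"
    by (rule sum.cong, simp, simp add: sum_distrib_left, rule sum.cong)
       (auto simp: distrib_left zp_add mult_ac)
  also have "\<dots> = (\<Sum>t\<in>F. of_int (eta t) * (\<Sum>s\<in>F. zp (s * (1 + t))))"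
    by (subst sum.swap) (simp add: sum_distrib_left)
  also have "\<dots> = (\<Sum>t\<in>F. of_int (eta t) * (if 1 + t = 0 then of_nat p else 0))"
    by (rule sum.cong) (simp_all add: sum_F_zp_mult)
  also have "\<dots> = (\<Sum>t\<in>F. if t = -1 then of_int (eta (-1)) * of_nat p else 0)"
    by (rule sum.cong) (auto simp: add_eq_0_iff)
  also have "\<dots> = of_int (eta (-1)) * of_nat p" by (simp add: sum.delta)
  finally show ?thesis .
qed

text \<open>Character sums over the non-squares, via the sums over \<open>F\<^sup>*\<close> and against \<open>eta\<close>.\<close>

lemma sum_NSq_zp:
  assumes w: "w \<in> Fs" shows "(\<Sum>c\<in>NSq. zp (w * c)) = (- 1 - of_int (eta w) * gauss) / 2"
proof -
  have Fs_eq: "Fs = Sq \<union> NSq" and disj: "Sq \<inter> NSq = {}" by (auto simp: Sq_def NSq_def)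
  have "(\<Sum>c\<in>Fs. zp (c * w)) = -1" using sum_Fs_zp_mult[of w] w by simp
  hence sum: "(\<Sum>c\<in>Sq. zp (w * c)) + (\<Sum>c\<in>NSq. zp (w * c)) = - 1"
    unfolding Fs_eq by (subst (asm) sum.union_disjoint) (use disj in \<open>auto simp: mult.commute\<close>)
  have "(\<Sum>y\<in>F. of_int (eta y) * zp (w * y)) = (\<Sum>y\<in>{0} \<union> Sq \<union> NSq. of_int (eta y) * zp (w * y))"
    by (rule sum.cong) (auto simp: Sq_def NSq_def)
  also have "\<dots> = (\<Sum>y\<in>Sq. of_int (eta y) * zp (w * y)) + (\<Sum>y\<in>NSq. of_int (eta y) * zp (w * y))"
    by (subst sum.union_disjoint; (subst sum.union_disjoint)?) (auto simp: Sq_def NSq_def eta_def)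
  also have "(\<Sum>y\<in>Sq. of_int (eta y) * zp (w * y)) = (\<Sum>y\<in>Sq. zp (w * y))"
    by (rule sum.cong) (auto simp: Sq_def eta_def)
  also have "(\<Sum>y\<in>NSq. of_int (eta y) * zp (w * y)) = - (\<Sum>y\<in>NSq. zp (w * y))"
    by (simp add: sum_negf[symmetric]) (rule sum.cong, auto simp: NSq_def eta_def)
  finally have diff: "(\<Sum>c\<in>Sq. zp (w * c)) - (\<Sum>c\<in>NSq. zp (w * c)) = of_int (eta w) * gauss"
    using gauss_scale[of w] w by simp
  from sum diff show ?thesis by (simp add: field_simps)
qed

end

section \<open>Consequences of Condition A\<close>

lemma involution_card_even:
  assumes "finite X" "\<forall>x\<in>X. g x \<in> X \<and> g (g x) = x \<and> g x \<noteq> x"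
  shows "even (card X)"
  using assms
proof (induction "card X" arbitrary: X rule: less_induct)
  case less
  show ?case
  proof (cases "X = {}")
    case False
    then obtain x where x: "x \<in> X" by auto
    define Y where "Y = X - {x, g x}"
    have gx: "g x \<in> X" "g x \<noteq> x" using less.prems x by auto
    have sub: "{x, g x} \<subseteq> X" using gx x by auto
    have "card Y = card X - card {x, g x}"
      unfolding Y_def using sub less.prems(1) by (subst card_Diff_subset) (auto intro: finite_subset)
    moreover have "card {x, g x} \<le> card X" using sub less.prems(1) by (rule card_mono[rotated])
    ultimately have cY: "card Y + 2 = card X" using gx by simp
    have "\<forall>y\<in>Y. g y \<in> Y \<and> g (g y) = y \<and> g y \<noteq> y"
    proof
      fix y assume y: "y \<in> Y"
      hence yX: "y \<in> X" "y \<noteq> x" "y \<noteq> g x" by (auto simp: Y_def)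
      have "g y \<noteq> x" "g y \<noteq> g x" using yX less.prems(2) x by metis+
      thus "g y \<in> Y \<and> g (g y) = y \<and> g y \<noteq> y" using yX less.prems(2) by (auto simp: Y_def)
    qed
    moreover have "finite Y" using less.prems(1) by (simp add: Y_def)
    ultimately have "even (card Y)" using less.hyps cY by simp
    thus ?thesis using cY by (metis even_add even_numeral)
  qed simp
qed

lemma sum_by_fibres:
  fixes g :: "'a::finite \<Rightarrow> 'b"
  assumes "finite S" "\<And>y. g y \<in> S"
  shows "(\<Sum>y\<in>UNIV. h (g y)) = (\<Sum>c\<in>S. of_nat (card {y. g y = c}) * h c)"
proof -
  have "(\<Sum>y\<in>UNIV. h (g y)) = (\<Sum>c\<in>S. \<Sum>y\<in>{y\<in>UNIV. g y = c}. h (g y))"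
    by (rule sum.group[symmetric]) (use assms in auto)
  also have "\<dots> = (\<Sum>c\<in>S. of_nat (card {y. g y = c}) * h c)"
    by (rule sum.cong) auto
  finally show ?thesis .
qed

locale condition_A = odd_field_p2k p k for p k +
  fixes f :: "'a::{field,finite} \<Rightarrow> 'a" and eps :: int and l :: int and fstar :: "'a \<Rightarrow> 'a"
  assumes f_in_F [simp, intro]: "f x \<in> prime_subfield p"
    and f_0 [simp]: "f 0 = 0"
    and f_even: "f (- x) = f x"
    and gcd_l: "gcd (l - 1) (int p - 1) = 1"
    and f_homogeneous: "\<alpha> \<in> prime_subfield p \<Longrightarrow> f (\<alpha> * x) = \<alpha> powi l * f x"
    and eps_cases: "eps = 1 \<or> eps = -1"
    and fstar_in_F [simp, intro]: "fstar b \<in> prime_subfield p"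
    and walsh_eq: "walsh p k f b = of_int eps * of_nat (p ^ k) * zp (fstar b)"
begin

abbreviation eps_pk :: complex where "eps_pk \<equiv> of_int eps * of_nat (p ^ k)"

text \<open>On \<open>F\<^sup>*\<close> the exponent \<open>l\<close> only matters modulo \<open>p - 1\<close>; we replace it by the natural number
  \<open>hexp\<close> (homogeneity exponent) \<open>\<ge> 1\<close>.\<close>

definition hexp :: nat where "hexp = nat (l mod (int p - 1)) + (p - 1)"

lemma hexp_ge_1: "hexp \<ge> 1" using p_ge3 by (simp add: hexp_def)

lemma f_homogeneous_hexp: assumes a: "a \<in> Fs" shows "f (a * x) = a ^ hexp * f x"
proof -
  define m where "m = int p - 1"
  have m: "m = int (p - 1)" and mpos: "m > 0" using p_ge3 by (simp_all add: m_def of_nat_diff)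
  have a0: "a \<noteq> 0" using a by simp
  have am: "a powi m = 1" using fermat_F[OF a] by (simp add: m)
  have "l = m * (l div m) + l mod m" by simp
  hence "a powi l = a powi (m * (l div m)) * a powi (l mod m)" by (metis power_int_add a0)
  also have "a powi (m * (l div m)) = 1" by (simp add: power_int_mult am)
  also have "a powi (l mod m) = a ^ nat (l mod m)"
  proof -
    have "l mod m = int (nat (l mod m))" using mpos by simp
    thus ?thesis by (metis power_int_of_nat)
  qed
  also have "\<dots> = a ^ hexp" using fermat_F[OF a] by (simp add: hexp_def power_add m_def)
  finally show ?thesis using f_homogeneous[of a x] a by simp
qed

lemma coprime_hexp: "coprime (hexp - 1) (p - 1)"
proof -
  define m where "m = int p - 1"
  have m: "m = int (p - 1)" and mpos: "m > 0" using p_ge3 by (simp_all add: m_def of_nat_diff)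
  have "int (hexp - 1) = l mod m + m - 1" using p_ge3 mpos
    by (simp add: hexp_def m_def of_nat_diff)
  also have "\<dots> = (1 - l div m) * m + (l - 1)" by (simp add: algebra_simps)
  finally have "gcd m (int (hexp - 1)) = gcd m (l - 1)" by (simp add: gcd_add_mult)
  also have "\<dots> = 1" using gcd_l by (simp add: m_def gcd.commute)
  finally have "gcd (int (p - 1)) (int (hexp - 1)) = 1" by (simp add: m)
  hence "gcd (p - 1) (hexp - 1) = 1" by (metis gcd_int_int_eq of_nat_eq_1_iff)
  thus ?thesis by (simp add: coprime_iff_gcd_eq_1 gcd.commute)
qed

lemma odd_hexp_minus_1: "odd (hexp - 1)"
proof
  assume "even (hexp - 1)"
  moreover have "even (p - 1)" using odd_p p_ge3 by simp
  ultimately have "is_unit (2::nat)" using coprime_common_divisor[OF coprime_hexp] by blast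
  thus False by simp
qed

definition fibre :: "'a \<Rightarrow> 'a \<Rightarrow> nat" where "fibre b c = card {y. f y + tr (b * y) = c}"

lemma sum_by_fibre:
  "(\<Sum>y\<in>UNIV. h (f y + tr (b * y))) = (\<Sum>c\<in>F. of_nat (fibre b c) * h c)"
  unfolding fibre_def by (rule sum_by_fibres) auto

text \<open>By cyclotomic independence, \<open>walsh p k f b = eps p^k zeta ^ fstar b\<close> pins down the fibre counts:
  they are constant, except for an excess \<open>eps p\<^sup>k\<close> at \<open>c = fstar b\<close>.\<close>

lemma fibre_formula:
  "\<exists>A::int. \<forall>c\<in>F. int (fibre b c) = A + (if c = fstar b then eps * int (p ^ k) else 0)"
proof -
  obtain j0 where j0: "j0 < p" "fstar b = of_nat j0" using fstar_in_F F_cases by blast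
  define a where "a i = int (fibre b (of_nat i)) - (if i = j0 then eps * int (p ^ k) else 0)" for i
  have "(\<Sum>i<p. of_nat (fibre b (of_nat i)) * zeta p ^ i) = walsh p k f b"
    by (simp add: walsh_def sum_by_fibre sum_F zp_of_nat)
  also have "\<dots> = (\<Sum>i<p. if i = j0 then of_int (eps * int (p ^ k)) * zeta p ^ i else 0)"
    using walsh_eq[of b] j0 by (simp add: zp_of_nat sum.delta)
  finally have "(\<Sum>i<p. of_nat (fibre b (of_nat i)) * zeta p ^ i
      - (if i = j0 then of_int (eps * int (p ^ k)) * zeta p ^ i else 0)) = 0"
    by (simp only: sum_subtractf) simp
  moreover have "of_int (a i) * zeta p ^ i = of_nat (fibre b (of_nat i)) * zeta p ^ i
      - (if i = j0 then of_int (eps * int (p ^ k)) * zeta p ^ i else 0)" for i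
    by (simp add: a_def algebra_simps)
  ultimately have "(\<Sum>i<p. of_int (a i) * zeta p ^ i) = 0" by simp
  from zeta_relation_const[OF prime_p this] have eq: "\<forall>i<p. a i = a (p - 1)" .
  show ?thesis
  proof (intro exI ballI)
    fix c assume "c \<in> F"
    then obtain i where i: "i < p" "c = of_nat i" using F_cases by blast
    have "c = fstar b \<longleftrightarrow> i = j0" using i j0 by (simp add: of_nat_eq_iff)
    thus "int (fibre b c) = a (p - 1) + (if c = fstar b then eps * int (p ^ k) else 0)"
      using eq i by (auto simp: a_def)
  qed
qed

lemma sum_fibre: "(\<Sum>c\<in>F. int (fibre b c)) = int (p ^ (2*k))"
  using sum_by_fibre[of "\<lambda>_. 1::int" b] card_UNIV by simp

lemma twisted_walsh:
  assumes t: "t \<in> Fs"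
  shows "(\<Sum>y\<in>UNIV. zp (t * (f y + tr (b * y)))) = eps_pk * zp (t * fstar b)"
proof -
  obtain A where A: "\<forall>c\<in>F. int (fibre b c) = A + (if c = fstar b then eps * int (p ^ k) else 0)"
    using fibre_formula by blast
  have "(\<Sum>y\<in>UNIV. zp (t * (f y + tr (b * y)))) = (\<Sum>c\<in>F. of_nat (fibre b c) * zp (t * c))"
    by (rule sum_by_fibre)
  also have "\<dots> = (\<Sum>c\<in>F. of_int A * zp (c * t)
                      + (if c = fstar b then eps_pk * zp (t * fstar b) else 0))"
  proof (rule sum.cong)
    fix c assume "c \<in> F"
    have "(of_nat (fibre b c) :: complex) = of_int (int (fibre b c))" by simp
    also have "\<dots> = of_int A + (if c = fstar b then eps_pk else 0)" using A \<open>c \<in> F\<close> by simp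
    finally have "(of_nat (fibre b c) :: complex) = of_int A + (if c = fstar b then eps_pk else 0)" .
    thus "of_nat (fibre b c) * zp (t * c)
        = of_int A * zp (c * t) + (if c = fstar b then eps_pk * zp (t * fstar b) else 0)"
      by (simp add: algebra_simps mult.commute)
  qed simp
  also have "\<dots> = of_int A * (\<Sum>c\<in>F. zp (c * t)) + eps_pk * zp (t * fstar b)"
    by (simp add: sum.distrib sum_distrib_left sum.delta)
  also have "(\<Sum>c\<in>F. zp (c * t)) = 0" using sum_F_zp_mult[of t] t by simp
  finally show ?thesis by simp
qed

text \<open>Parity argument for \<open>fstar 0 = 0\<close>: the zeros of \<open>f\<close> other than \<open>0\<close> come in pairs \<open>\<plusminus>y\<close>,
  so the fibre over \<open>0\<close> at \<open>b = 0\<close> is odd; were \<open>fstar 0 \<noteq> 0\<close>, this fibre would be the common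
  value \<open>A\<close> with \<open>p A + eps p^k = p^(2k)\<close>, forcing \<open>A\<close> even.\<close>

lemma fstar_0: "fstar 0 = 0"
proof (rule ccontr)
  assume ne: "fstar 0 \<noteq> 0"
  obtain A where A: "\<forall>c\<in>F. int (fibre 0 c) = A + (if c = fstar 0 then eps * int (p ^ k) else 0)"
    using fibre_formula by blast
  have "int (p ^ (2*k)) = (\<Sum>c\<in>F. A + (if c = fstar 0 then eps * int (p ^ k) else 0))"
    using sum_fibre[of 0] A by simp
  also have "\<dots> = int p * A + eps * int (p ^ k)" by (simp add: sum.distrib card_F)
  finally have pA: "int p * A + eps * int (p ^ k) = int (p ^ (2*k))" by simp
  have "odd (int (p ^ (2*k)))" "odd (eps * int (p ^ k))" using odd_p eps_cases by auto
  hence "even (int p * A)" using pA by (metis even_add)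
  hence "even A" using odd_p by simp
  define X where "X = {y::'a. f y = 0}"
  have "even (card (X - {0}))"
    by (rule involution_card_even[where g = uminus]) (auto simp: X_def f_even neg_ne_self two_ne_0)
  moreover have "card X = Suc (card (X - {0}))" by (subst card.remove[of X 0]) (auto simp: X_def)
  moreover have "int (card X) = A" using A[rule_format, OF zero_in_F] ne by (simp add: X_def fibre_def)
  ultimately have "odd (card X)" by simp
  thus False using \<open>even A\<close> \<open>int (card X) = A\<close> by (metis even_of_nat)
qed

text \<open>The sums \<open>W u b = \<Sum>x. zeta ^ (u f x + tr (b x))\<close> for \<open>u \<in> F\<close>.  For \<open>u = 0\<close> they are character sums; for
  \<open>u = inverse (t ^ (hexp - 1))\<close> the substitution \<open>x = t y\<close> and homogeneity turn them into twisted Walsh sums.\<close>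

definition W :: "'a \<Rightarrow> 'a \<Rightarrow> complex" where "W u b = (\<Sum>x\<in>UNIV. zp (u * f x + tr (b * x)))"

lemma W_0: "W 0 b = (if b = 0 then of_nat (p ^ (2*k)) else 0)"
  using sum_chi[of b] card_UNIV by (simp add: W_def)

lemma W_twist:
  assumes t: "t \<in> Fs" shows "W (inverse (t ^ (hexp - 1))) b = eps_pk * zp (t * fstar b)"
proof -
  define u where "u = inverse (t ^ (hexp - 1))"
  have "hexp = Suc (hexp - 1)" using hexp_ge_1 by simp
  hence "t ^ hexp = t ^ (hexp - 1) * t" by (metis power_Suc2)
  hence ut: "u * t ^ hexp = t" using t by (simp add: u_def mult.assoc[symmetric])
  have "W u b = (\<Sum>y\<in>UNIV. zp (u * f (t * y) + tr (b * (t * y))))"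
    unfolding W_def by (rule sum.reindex_bij_witness[of _ "\<lambda>y. t * y" "\<lambda>x. x / t"]) (use t in auto)
  also have "\<dots> = (\<Sum>y\<in>UNIV. zp (t * (f y + tr (b * y))))"
  proof (rule sum.cong)
    fix y
    have "u * f (t * y) = t * f y" using f_homogeneous_hexp[OF t] ut by (simp add: mult.assoc[symmetric])
    moreover have "tr (b * (t * y)) = t * tr (b * y)" using tr_scale[of t "b * y"] t by (simp add: mult_ac)
    ultimately show "zp (u * f (t * y) + tr (b * (t * y))) = zp (t * (f y + tr (b * y)))"
      by (simp add: distrib_left)
  qed simp
  also have "\<dots> = eps_pk * zp (t * fstar b)" by (rule twisted_walsh[OF t])
  finally show ?thesis by (simp add: u_def)
qed

section \<open>The character values of \<open>D\<close>\<close>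

definition D :: "'a set" where "D = {x. x \<noteq> 0 \<and> is_nonsquare_Fp p (f x)}"

lemma D_eq: "D = {x. f x \<in> NSq}"
  by (auto simp: D_def is_nonsquare_Fp_def NSq_def is_sq_def)

lemma uminus_in_D: "x \<in> D \<Longrightarrow> - x \<in> D" by (simp add: D_eq f_even)

definition D_hat :: "'a \<Rightarrow> complex" where "D_hat b = (\<Sum>x\<in>D. chi b x)"

lemma D_hat_0: "D_hat 0 = of_nat (card D)" by (simp add: D_hat_def)

lemma indicator_NSq_expand:
  "of_nat p * (if f x \<in> NSq then 1 else 0) = (\<Sum>c\<in>NSq. \<Sum>u\<in>F. zp (u * (f x - c)))"
proof -
  have "(\<Sum>c\<in>NSq. \<Sum>u\<in>F. zp (u * (f x - c))) = (\<Sum>c\<in>NSq. if f x = c then of_nat p else 0)"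
    by (rule sum.cong) (auto simp: sum_F_zp_mult NSq_def)
  thus ?thesis by (simp add: sum.delta')
qed

lemma D_hat_expand: "of_nat p * D_hat b = (\<Sum>u\<in>F. \<Sum>c\<in>NSq. zp (- (u * c)) * W u b)"
proof -
  have "(\<Sum>x\<in>UNIV. (if f x \<in> NSq then 1 else 0) * chi b x) = (\<Sum>x\<in>UNIV. if f x \<in> NSq then chi b x else 0)"
    by (rule sum.cong) auto
  also have "\<dots> = D_hat b"
    unfolding D_hat_def D_eq using sum.inter_filter[of UNIV "chi b" "\<lambda>x. f x \<in> NSq"] by simp
  finally have "D_hat b = (\<Sum>x\<in>UNIV. (if f x \<in> NSq then 1 else 0) * chi b x)" ..
  hence "of_nat p * D_hat b = (\<Sum>x\<in>UNIV. (of_nat p * (if f x \<in> NSq then 1 else 0)) * chi b x)"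
    by (simp add: sum_distrib_left mult_ac)
  also have "\<dots> = (\<Sum>x\<in>UNIV. \<Sum>c\<in>NSq. \<Sum>u\<in>F. zp (u * (f x - c)) * chi b x)"
    by (simp only: indicator_NSq_expand sum_distrib_right)
  also have "\<dots> = (\<Sum>x\<in>UNIV. \<Sum>c\<in>NSq. \<Sum>u\<in>F. zp (- (u * c)) * zp (u * f x + tr (b * x)))"
  proof (intro sum.cong refl)
    fix x c u assume "c \<in> NSq" "u \<in> F"
    hence cu: "c \<in> F" "u \<in> F" by (auto simp: NSq_def)
    have eq: "u * (f x - c) = - (u * c) + u * f x" by (simp add: algebra_simps)
    have "zp (- (u * c) + u * f x) = zp (- (u * c)) * zp (u * f x)" by (rule zp_add) (use cu in auto)
    hence "zp (u * (f x - c)) = zp (- (u * c)) * zp (u * f x)" by (simp only: eq)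
    moreover have "zp (u * f x + tr (b * x)) = zp (u * f x) * chi b x" using cu by (simp add: zp_add)
    ultimately show "zp (u * (f x - c)) * chi b x = zp (- (u * c)) * zp (u * f x + tr (b * x))"
      by (simp add: mult_ac)
  qed
  also have "\<dots> = (\<Sum>u\<in>F. \<Sum>c\<in>NSq. \<Sum>x\<in>UNIV. zp (- (u * c)) * zp (u * f x + tr (b * x)))"
    by (subst sum.swap, subst (2) sum.swap, subst sum.swap) (rule refl)
  also have "\<dots> = (\<Sum>u\<in>F. \<Sum>c\<in>NSq. zp (- (u * c)) * W u b)"
    by (simp add: W_def sum_distrib_left)
  finally show ?thesis .
qed

text \<open>Since \<open>hexp - 1\<close> is odd and coprime to \<open>p - 1\<close>, \<open>t \<mapsto> inverse (t ^ (hexp - 1))\<close> permutes \<open>F\<^sup>*\<close> and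
  preserves \<open>eta\<close>.\<close>

lemma inverse_power_bij:
  "bij_betw (\<lambda>t. inverse (t ^ (hexp - 1))) Fs Fs"
proof -
  have "bij_betw (\<lambda>t. t ^ (hexp - 1)) Fs Fs"
    using power_bij_Fs[OF coprime_hexp] by (simp add: bij_betw_def)
  moreover have "bij_betw inverse Fs Fs"
    by (rule bij_betwI[of _ _ _ inverse]) auto
  ultimately show ?thesis using bij_betw_trans by (fastforce simp: comp_def)
qed

lemma eta_minus_inverse_power:
  assumes t: "t \<in> Fs" shows "eta (- inverse (t ^ (hexp - 1))) = eta (-1) * eta t"
proof -
  have "eta (- inverse (t ^ (hexp - 1))) = eta (-1) * eta (inverse (t ^ (hexp - 1)))"
    using t eta_mult[of "-1" "inverse (t ^ (hexp - 1))"] by simp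
  also have "eta (inverse (t ^ (hexp - 1))) = eta t ^ (hexp - 1)"
    using t by (simp add: eta_inverse eta_power)
  also have "\<dots> = eta t" using eta_pm1[OF t] odd_hexp_minus_1 by auto
  finally show ?thesis .
qed

lemma D_hat_summand:
  assumes t: "t \<in> Fs"
  shows "(\<Sum>c\<in>NSq. zp (- (inverse (t ^ (hexp - 1)) * c)) * W (inverse (t ^ (hexp - 1))) b)
       = ((- 1 - of_int (eta (-1)) * of_int (eta t) * gauss) / 2) * (eps_pk * zp (t * fstar b))"
proof -
  define u where "u = inverse (t ^ (hexp - 1))"
  have w: "- u \<in> Fs" using t by (auto simp: u_def)
  have "(\<Sum>c\<in>NSq. zp (- (u * c)) * W u b) = (\<Sum>c\<in>NSq. zp ((- u) * c)) * W u b"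
    by (simp add: sum_distrib_right)
  also have "(\<Sum>c\<in>NSq. zp ((- u) * c)) = (- 1 - of_int (eta (- u)) * gauss) / 2"
    by (rule sum_NSq_zp[OF w])
  finally show ?thesis
    using W_twist[OF t] eta_minus_inverse_power[OF t] by (simp add: u_def)
qed

text \<open>The closed form of \<open>D_hat\<close>: the \<open>u = 0\<close> term is \<open>|NSq| W 0 b\<close>; the remaining terms
  combine, after the reindexing \<open>u = inverse (t ^ (hexp - 1))\<close>, into \<open>gauss\<^sup>2 = eta(-1) p\<close> times \<open>eta (fstar b)\<close>.\<close>

lemma D_hat_formula:
  "of_nat p * D_hat b = of_nat (card NSq) * W 0 b
     + eps_pk / 2 * (1 - (if fstar b = 0 then of_nat p else 0) - of_int (eta (fstar b)) * of_nat p)"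
proof -
  define a where "a = fstar b"
  have aF: "a \<in> F" by (simp add: a_def)
  define H where "H u = (\<Sum>c\<in>NSq. zp (- (u * c)) * W u b)" for u
  have "of_nat p * D_hat b = H 0 + (\<Sum>u\<in>Fs. H u)"
    unfolding D_hat_expand H_def by (rule sum.remove) auto
  also have "H 0 = of_nat (card NSq) * W 0 b" by (simp add: H_def)
  also have "(\<Sum>u\<in>Fs. H u) = (\<Sum>t\<in>Fs. H (inverse (t ^ (hexp - 1))))"
    using sum.reindex_bij_betw[OF inverse_power_bij, of H] by simp
  also have "\<dots> = (\<Sum>t\<in>Fs. ((- 1 - of_int (eta (-1)) * of_int (eta t) * gauss) / 2) * (eps_pk * zp (t * a)))"
  proof (rule sum.cong[OF refl])
    fix t assume "t \<in> Fs"
    thus "H (inverse (t ^ (hexp - 1)))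
        = ((- 1 - of_int (eta (-1)) * of_int (eta t) * gauss) / 2) * (eps_pk * zp (t * a))"
      unfolding H_def a_def by (rule D_hat_summand)
  qed
  also have "\<dots> = eps_pk / 2 * (- (\<Sum>t\<in>Fs. zp (t * a))
                    - of_int (eta (-1)) * gauss * (\<Sum>t\<in>Fs. of_int (eta t) * zp (a * t)))"
    by (simp add: sum_distrib_left sum_distrib_right sum_subtractf sum_negf algebra_simps diff_divide_distrib)
  also have "(\<Sum>t\<in>Fs. zp (t * a)) = (if a = 0 then of_nat p else 0) - 1" by (rule sum_Fs_zp_mult[OF aF])
  also have "(\<Sum>t\<in>Fs. of_int (eta t) * zp (a * t)) = of_int (eta a) * gauss"
    using gauss_scale[OF aF] sum.remove[of F 0 "\<lambda>t. of_int (eta t) * zp (a * t)"]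
    by (simp add: eta_def)
  also have "of_int (eta (-1)) * gauss * (of_int (eta a) * gauss)
           = of_int (eta (-1) * eta (-1)) * of_int (eta a) * (of_nat p :: complex)"
    using gauss_square by (simp add: algebra_simps)
  also have "eta (-1) * eta (-1) = 1" by (simp add: eta_def)
  finally show ?thesis by (simp add: a_def algebra_simps)
qed

text \<open>Hence \<open>D_hat\<close> takes only the two values \<open>r\<close>, \<open>s\<close> on nonzero \<open>b\<close>, according as \<open>fstar b\<close> is a
  non-square or not, and \<open>D_hat 0 = |D|\<close> is determined via \<open>fstar 0 = 0\<close>.\<close>

definition r :: real where "r = real_of_int eps * real (p ^ k) * (1 + real p) / (2 * real p)"
definition s :: real where "s = real_of_int eps * real (p ^ k) * (1 - real p) / (2 * real p)"

lemma D_hat_two_values: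
  assumes b: "b \<noteq> 0" shows "D_hat b = complex_of_real (if fstar b \<in> NSq then r else s)"
proof -
  have "(1 - (if fstar b = 0 then of_nat p else 0) - of_int (eta (fstar b)) * of_nat p :: complex)
         = (if fstar b \<in> NSq then 1 + of_nat p else 1 - of_nat p)"
    using fstar_in_F[of b] by (auto simp: eta_def NSq_def)
  hence "of_nat p * D_hat b = eps_pk / 2 * (if fstar b \<in> NSq then 1 + of_nat p else 1 - of_nat p)"
    using D_hat_formula[of b] W_0[of b] b by simp
  hence "D_hat b = eps_pk * (if fstar b \<in> NSq then 1 + of_nat p else 1 - of_nat p) / (2 * of_nat p)"
    using p_gt0 by (simp add: field_simps)
  thus ?thesis by (simp add: r_def s_def)
qed

lemma D_hat_quadratic:
  assumes "b \<noteq> 0" shows "D_hat b * D_hat b = complex_of_real (r + s) * D_hat b - complex_of_real (r * s)"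
  using D_hat_two_values[OF assms] by (auto simp: algebra_simps)

lemma card_D: "real (card D) = ((real p - 1) * real (p ^ (2*k)) + real_of_int eps * real (p ^ k) * (1 - real p)) / (2 * real p)"
proof -
  have "(of_nat (2 * card NSq) :: complex) = of_nat (p - 1)" using card_NSq by simp
  hence "(of_nat (card NSq) :: complex) = (of_nat p - 1) / 2" using p_ge3 by (simp add: of_nat_diff field_simps)
  hence "of_nat p * D_hat 0 = (of_nat p - 1) / 2 * of_nat (p ^ (2*k)) + eps_pk / 2 * (1 - of_nat p)"
    using D_hat_formula[of 0] W_0[of 0] fstar_0 by (simp add: eta_def)
  hence "2 * of_nat p * D_hat 0 = 2 * ((of_nat p - 1) / 2 * of_nat (p ^ (2*k)) + eps_pk / 2 * (1 - of_nat p))"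
    by (simp only: mult.assoc)
  also have "\<dots> = (of_nat p - 1) * of_nat (p ^ (2*k)) + eps_pk * (1 - of_nat p)"
    by (simp only: distrib_left) (simp add: field_simps)
  finally have "(of_nat (card D) :: complex)
      = ((of_nat p - 1) * of_nat (p ^ (2*k)) + eps_pk * (1 - of_nat p)) / (2 * of_nat p)"
    using p_gt0 by (simp add: D_hat_0 eq_divide_eq mult.commute)
  hence "complex_of_real (real (card D)) = complex_of_real (((real p - 1) * real (p ^ (2*k))
           + real_of_int eps * real (p ^ k) * (1 - real p)) / (2 * real p))"
    by simp
  thus ?thesis using of_real_eq_iff by blast
qed

end

section \<open>Counting differences\<close>

text \<open>Two identities in the reals that turn the Fourier-side data into the parameters; here
  \<open>n = p ^ k\<close>, \<open>m = p ^ (k - 1)\<close>, \<open>P = p\<close> and \<open>E = eps\<close>.\<close>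

lemma pds_size_identity:
  fixes P m E n :: real
  assumes "P > 0" "n = P * m"
  shows "((P - 1) * n^2 + E * n * (1 - P)) / (2 * P) = (1/2) * (n - m) * (n - E)"
  using assms by (simp add: field_simps power2_eq_square)

lemma pds_lambda_identities:
  fixes P m E n d r s :: real
  assumes P: "P > 0" and m: "m > 0" and E: "E = 1 \<or> E = -1" and n: "n = P * m"
    and d: "d = (1/2) * (n - m) * (n - E)"
    and r: "r = E * n * (1 + P) / (2 * P)" and s: "s = E * n * (1 - P) / (2 * P)"
  shows "(d^2 - (r + s) * d + r * s) / n^2 = (1/2) * (n - m) * ((1/2) * (n - m) - E)"
    and "(d^2 - (r + s) * d + r * s) / n^2 + (r + s) = (1/4) * (n - m)^2 - (3 * E / 2) * (n - m) + E * n"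
proof -
  have n0: "n \<noteq> 0" using P m n by simp
  have rs1: "r + s = E * m" using P unfolding r s n by (simp add: field_simps)
  have rs2: "r * s = E^2 * m^2 * (1 - P^2) / 4"
    using P unfolding r s n by (simp add: field_simps power2_eq_square)
  have E2: "E^2 = 1" using E by auto
  have key: "d^2 - (r + s) * d + r * s = n^2 * ((1/2) * (n - m) * ((1/2) * (n - m) - E))"
    unfolding rs1 rs2 d E2 n by (simp add: field_simps power2_eq_square) (use E in \<open>auto simp: algebra_simps\<close>)
  show "(d^2 - (r + s) * d + r * s) / n^2 = (1/2) * (n - m) * ((1/2) * (n - m) - E)"
    using n0 key by simp
  show "(d^2 - (r + s) * d + r * s) / n^2 + (r + s) = (1/4) * (n - m)^2 - (3 * E / 2) * (n - m) + E * n"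
    using n0 key rs1 by (simp add: field_simps power2_eq_square)
qed

context condition_A
begin

definition diff_count :: "'a \<Rightarrow> nat" where
  "diff_count g = card {(x, y). x \<in> D \<and> y \<in> D \<and> x - y = g}"

lemma diff_count_as_sum:
  "(of_nat (diff_count g) :: complex) = (\<Sum>x\<in>D. \<Sum>y\<in>D. if x - y = g then 1 else 0)"
proof -
  have "{(x, y). x \<in> D \<and> y \<in> D \<and> x - y = g} = {z\<in>D \<times> D. fst z - snd z = g}" by auto
  hence "(of_nat (diff_count g) :: complex) = (\<Sum>z\<in>D \<times> D. if fst z - snd z = g then 1 else 0)"
    by (simp add: diff_count_def sum.inter_filter[symmetric])
  also have "\<dots> = (\<Sum>x\<in>D. \<Sum>y\<in>D. if x - y = g then 1 else 0)"
    by (simp add: sum.cartesian_product split_def)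
  finally show ?thesis .
qed

text \<open>Fourier inversion: \<open>q \<cdot> diff_count g = \<Sum>\<^sub>b |D_hat b|\<^sup>2 chi b (-g)\<close>, using that \<open>D = -D\<close>.\<close>

lemma D_hat_uminus: "(\<Sum>y\<in>D. chi b (- y)) = D_hat b"
  unfolding D_hat_def by (rule sum.reindex_bij_witness[of _ uminus uminus]) (auto simp: uminus_in_D)

lemma diff_count_fourier:
  "of_nat (p ^ (2*k)) * of_nat (diff_count g) = (\<Sum>b\<in>UNIV. D_hat b * D_hat b * chi b (- g))"
proof -
  have "of_nat (p ^ (2*k)) * (of_nat (diff_count g) :: complex)
      = (\<Sum>x\<in>D. \<Sum>y\<in>D. \<Sum>b\<in>UNIV. chi b (x - y - g))"
    unfolding diff_count_as_sum sum_distrib_left by (intro sum.cong refl) (simp add: sum_chi_dual card_UNIV)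
  also have "\<dots> = (\<Sum>x\<in>D. \<Sum>y\<in>D. \<Sum>b\<in>UNIV. chi b x * chi b (- y) * chi b (- g))"
  proof (intro sum.cong refl)
    fix x y b
    have "chi b (x - y - g) = chi b (x + (- y) + (- g))" by simp
    also have "\<dots> = chi b x * chi b (- y) * chi b (- g)" by (simp only: chi_add)
    finally show "chi b (x - y - g) = chi b x * chi b (- y) * chi b (- g)" .
  qed
  also have "\<dots> = (\<Sum>b\<in>UNIV. \<Sum>x\<in>D. \<Sum>y\<in>D. chi b x * chi b (- y) * chi b (- g))"
    by (subst sum.swap, subst (2) sum.swap) (rule refl)
  also have "\<dots> = (\<Sum>b\<in>UNIV. (\<Sum>x\<in>D. chi b x) * (\<Sum>y\<in>D. chi b (- y)) * chi b (- g))"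
    by (rule sum.cong[OF refl]) (simp only: sum_distrib_left sum_distrib_right, rule sum.swap)
  also have "\<dots> = (\<Sum>b\<in>UNIV. D_hat b * D_hat b * chi b (- g))"
    by (simp only: D_hat_uminus D_hat_def)
  finally show ?thesis .
qed

lemma sum_D_hat_chi:
  "(\<Sum>b\<in>UNIV. D_hat b * chi b (- g)) = (if g \<in> D then of_nat (p ^ (2*k)) else 0)"
proof -
  have "(\<Sum>b\<in>UNIV. D_hat b * chi b (- g)) = (\<Sum>b\<in>UNIV. \<Sum>x\<in>D. chi b (x + - g))"
    by (simp only: D_hat_def sum_distrib_right chi_add)
  also have "\<dots> = (\<Sum>x\<in>D. \<Sum>b\<in>UNIV. chi b (x + - g))" by (rule sum.swap)
  also have "\<dots> = (\<Sum>x\<in>D. if x = g then of_nat (p ^ (2*k)) else 0)"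
    by (rule sum.cong[OF refl]) (simp add: sum_chi_dual card_UNIV)
  finally show ?thesis by (simp add: sum.delta')
qed

text \<open>Replacing \<open>D_hat b\<^sup>2\<close> by \<open>(r + s) D_hat b - r s\<close> for \<open>b \<noteq> 0\<close> and using orthogonality gives
  the number of differences in terms of \<open>|D|\<close>, \<open>r\<close>, \<open>s\<close> and whether \<open>g \<in> D\<close>.\<close>

lemma diff_count_formula:
  assumes g: "g \<noteq> 0"
  shows "real (p ^ (2*k)) * real (diff_count g)
       = (real (card D))^2 - (r + s) * real (card D) + r * s
         + (if g \<in> D then (r + s) * real (p ^ (2*k)) else 0)"
proof -
  define R where "R = complex_of_real (r + s)"
  define Q where "Q = complex_of_real (r * s)"
  define d where "d = (of_nat (card D) :: complex)"
  define T where "T b = (R * D_hat b - Q) * chi b (- g)" for b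
  have sum_chi_g: "(\<Sum>b\<in>UNIV. chi b (- g)) = 0" using sum_chi_dual[of "-g"] g by simp
  have "(\<Sum>b\<in>UNIV. T b) = R * (\<Sum>b\<in>UNIV. D_hat b * chi b (- g)) - Q * (\<Sum>b\<in>UNIV. chi b (- g))"
    by (simp add: T_def algebra_simps sum_subtractf sum_distrib_left)
  also have "\<dots> = R * (if g \<in> D then of_nat (p ^ (2*k)) else 0)"
    by (simp only: sum_D_hat_chi sum_chi_g) simp
  finally have sum_T: "(\<Sum>b\<in>UNIV. T b) = R * (if g \<in> D then of_nat (p ^ (2*k)) else 0)" .
  have "(\<Sum>b\<in>UNIV. D_hat b * D_hat b * chi b (- g)) = d * d + (\<Sum>b\<in>UNIV - {0}. T b)"
    by (subst sum.remove[of _ 0]) (auto simp: D_hat_0 d_def T_def D_hat_quadratic R_def Q_def)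
  also have "(\<Sum>b\<in>UNIV - {0}. T b) = (\<Sum>b\<in>UNIV. T b) - (R * d - Q)"
    by (subst (2) sum.remove[of _ 0]) (auto simp: D_hat_0 d_def T_def)
  finally have "of_nat (p ^ (2*k)) * of_nat (diff_count g)
      = d * d + (R * (if g \<in> D then of_nat (p ^ (2*k)) else 0) - (R * d - Q))"
    unfolding diff_count_fourier sum_T .
  hence "complex_of_real (real (p ^ (2*k)) * real (diff_count g))
       = complex_of_real ((real (card D))^2 - (r + s) * real (card D) + r * s
         + (if g \<in> D then (r + s) * real (p ^ (2*k)) else 0))"
    by (simp add: R_def Q_def d_def power2_eq_square algebra_simps)
  thus ?thesis using of_real_eq_iff by blast
qed

theorem D_partial_difference_set:
  "partial_difference_set D
     (real p ^ (2*k))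
     ((1/2) * (real p ^ k - real p ^ (k-1)) * (real p ^ k - real_of_int eps))
     ((1/4) * (real p ^ k - real p ^ (k-1))^2
        - (3 * real_of_int eps / 2) * (real p ^ k - real p ^ (k-1))
        + real_of_int eps * real p ^ k)
     ((1/2) * (real p ^ k - real p ^ (k-1))
        * ((1/2) * (real p ^ k - real p ^ (k-1)) - real_of_int eps))"
proof -
  define P m n E where "P = real p" and "m = real p ^ (k - 1)" and "n = real p ^ k"
    and "E = real_of_int eps"
  have P: "P > 0" and m: "m > 0" using p_gt0 by (simp_all add: P_def m_def)
  have E: "E = 1 \<or> E = -1" using eps_cases by (auto simp: E_def)
  have nPm: "n = P * m" unfolding n_def P_def m_def using k_ge1 by (simp flip: power_Suc)
  have q: "real (p ^ (2*k)) = n^2" by (simp add: n_def power_mult mult.commute)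
  have d: "real (card D) = (1/2) * (n - m) * (n - E)"
    using card_D pds_size_identity[OF P nPm, of E] by (simp add: P_def n_def E_def power_mult mult.commute)
  have r: "r = E * n * (1 + P) / (2 * P)" and s: "s = E * n * (1 - P) / (2 * P)"
    by (simp_all add: r_def s_def E_def n_def P_def)
  note lambdas = pds_lambda_identities[OF P m E nPm d r s]
  have n0: "n^2 \<noteq> 0" using nPm P m by simp
  have count: "real (diff_count g) = (real (card D)^2 - (r + s) * real (card D) + r * s) / n^2
                + (if g \<in> D then r + s else 0)" if "g \<noteq> 0" for g
    using diff_count_formula[OF that] q n0 by (simp add: field_simps split: if_splits)
  show ?thesis
    unfolding partial_difference_set_def
    using d count lambdas card_UNIV
    by (auto simp: D_def diff_count_def n_def m_def E_def)
qed

end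

theorem mainTheorem7:
  fixes f :: "'a::{field,finite} \<Rightarrow> 'a" and p k :: nat and \<epsilon> :: int
  assumes "conditionA p k f \<epsilon>"
  shows "partial_difference_set {x. x \<noteq> 0 \<and> is_nonsquare_Fp p (f x)}
           (real p ^ (2*k))
           ((1/2) * (real p ^ k - real p ^ (k-1)) * (real p ^ k - real_of_int \<epsilon>))
           ((1/4) * (real p ^ k - real p ^ (k-1))^2
              - (3 * real_of_int \<epsilon> / 2) * (real p ^ k - real p ^ (k-1))
              + real_of_int \<epsilon> * real p ^ k)
           ((1/2) * (real p ^ k - real p ^ (k-1))
              * ((1/2) * (real p ^ k - real p ^ (k-1)) - real_of_int \<epsilon>))"
proof -
  have "\<exists>l. gcd (l - 1) (int p - 1) = 1 \<and>
      (\<forall>\<alpha>\<in>prime_subfield p. \<forall>x. f (\<alpha> * x) = \<alpha> powi l * f x)"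
    using assms unfolding conditionA_def by (elim conjE)
  then obtain l where l: "gcd (l - 1) (int p - 1) = 1 \<and>
      (\<forall>\<alpha>\<in>prime_subfield p. \<forall>x. f (\<alpha> * x) = \<alpha> powi l * f x)" ..
  have "\<exists>fstar :: 'a \<Rightarrow> 'a. (\<forall>b. fstar b \<in> prime_subfield p) \<and>
      (\<forall>b. walsh p k f b = of_int \<epsilon> * of_nat (p ^ k) * zeta_pow p (fstar b))"
    using assms unfolding conditionA_def by (elim conjE)
  then obtain fstar :: "'a \<Rightarrow> 'a" where fstar: "(\<forall>b. fstar b \<in> prime_subfield p) \<and>
      (\<forall>b. walsh p k f b = of_int \<epsilon> * of_nat (p ^ k) * zeta_pow p (fstar b))" ..
  interpret condition_A p k f \<epsilon> l fstar
    using assms l fstar by unfold_locales (auto simp: conditionA_def)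
  show ?thesis using D_partial_difference_set by (simp add: D_def)
qed

end
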